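(* Let $L\ge 1$ be real and $S=\mathbb{R}/L\mathbb{Z}$. If $A\subseteq S$ is Lebesgue measurable and $\lambda(A)=\xi L$ (so $\xi\in[0,1]$), then \[ \Phi(A)\ge \bigl(\xi+\sqrt{2\xi^2-2\xi+1}-1\bigr)L . \]
   Context: $S=\mathbb{R}/L\mathbb{Z}$ is the circle of circumference $L$ with its Lebesgue measure $\lambda$. For $x\in S$ and $t\in\mathbb{R}$, $x+t$ denotes addition in $S$. For a measurable set $A\subseteq S$, $\Phi(A)$ denotes the (two-dimensional Lebesgue) measure of the set $\{(x,t)\in A\times[0,1]\colon x+t\in A\}$; equivalently, the measure of the set of pairs $(x,y)\in A^2$ with $x\le y\le x+1$ along the circle (pairs wrapping around the circle included). *)

theory Defs
  imports "HOL-Analysis.Analysis" "HOL-Library.Real_Mod"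
begin

text \<open>
  The circle \<open>\<real>/L\<int>\<close> (for \<open>L > 0\<close>) is represented by the canonical representatives of its
  cosets, the half-open interval \<open>[0, L)\<close>. The translation \<open>x + t\<close> of a point of the circle by
  a real number is then addition followed by reduction modulo \<open>L\<close>, and the Lebesgue measure on
  the circle is the restriction of the Lebesgue measure to \<open>[0, L)\<close>; its measurable sets
  are exactly the Lebesgue measurable subsets of \<open>[0, L)\<close>.
\<close>

definition circle :: "real \<Rightarrow> real set" where
  "circle L = {0..<L}"

definition circle_add :: "real \<Rightarrow> real \<Rightarrow> real \<Rightarrow> real" where
  "circle_add L x t = (x + t) rmod L"

definition circle_measure :: "real \<Rightarrow> real measure" where
  "circle_measure L = lebesgue_on (circle L)"

text \<open>
  In the following definition \<open>lebesgue\<close> is the two-dimensional Lebesgue measure, on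
  \<open>\<real> \<times> \<real>\<close>. The set is bounded, so its measure is finite.
\<close>

definition Phi :: "real \<Rightarrow> real set \<Rightarrow> real" where
  "Phi L A = measure (lebesgue :: (real \<times> real) measure)
     {(x, t). x \<in> A \<and> t \<in> {0..1} \<and> circle_add L x t \<in> A}"

end

theory Submission
  imports Defs
begin

text \<open>
  Write \<open>\<Psi>\<close> for the measure of the pairs \<open>(x, t)\<close> with \<open>x \<in> A\<close>, \<open>x + t \<notin> A\<close>; then \<open>\<Phi>(A) = \<xi>L - \<Psi>\<close>, and the claim
  is \<open>\<Psi> \<le> (1 - \<rho>)L\<close> with \<open>\<rho>\<^sup>2 = \<xi>\<^sup>2 + (1-\<xi>)\<^sup>2\<close>. With \<open>c = \<xi>/\<rho>\<close>, \<open>s = (1-\<xi>)/\<rho>\<close> it has the linear form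
  \<open>\<Psi> \<le> (1-c) \<lambda>(A) + (1-s) \<lambda>(S - A)\<close>, which does not refer to \<open>\<xi>\<close> and can be proved on the line for finite
  unions of intervals. If every window of length less than 1 contains at most two endpoints, then the
  difference of the two sides is at least a sum of squares. In general, minimise it over the positions of the
  endpoints. If two endpoints collide, or two consecutive ones are at distance at least 1, then
  the problem reduces to fewer endpoints. Otherwise the second order conditions at a minimiser
  rule out three endpoints in a window of length less than 1. For these conditions to be available
  and strict, a small concave function is added that has kinks where two endpoints are at distance exactly 1.

  A measurable set is replaced by a union of intervals by cutting the circle into small cells and
  pushing the mass in each cell to its left end.
\<close>

section \<open>The kernels\<close>

text \<open>As a distribution, the second derivative of \<open>hat\<close> is twice the indicator of
  the distances below 1 minus 4 times the point mass at 0. Integrating by parts twice thus turns a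
  count of close pairs into an alternating sum of \<open>hat\<close> over endpoints.\<close>

definition hat :: "real \<Rightarrow> real" where
  "hat d = (max 0 (1 - \<bar>d\<bar>))\<^sup>2"

\<comment> \<open>The term \<open>d\<^sup>2\<close> makes \<open>- kink\<close> strictly concave on either half line; the term \<open>\<bar>\<bar>d\<bar> - 1\<bar>\<close> keeps a minimiser
  of \<open>penalized\<close> away from the points \<open>\<bar>d\<bar> = 1\<close>, where \<open>hat\<close> is not twice differentiable.\<close>
definition kink :: "real \<Rightarrow> real" where
  "kink d = \<bar>\<bar>d\<bar> - 1\<bar> + d\<^sup>2"

section \<open>Second differences of the two kernels\<close>

lemma hat_0 [simp]: "hat 0 = 1"
  by (simp add: hat_def)

lemma hat_minus [simp]: "hat (- d) = hat d"
  by (simp add: hat_def)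

lemma hat_minus_commute: "hat (x - y) = hat (y - x)"
  using hat_minus[of "x - y"] by simp

lemma hat_eq_0: "\<bar>d\<bar> \<ge> 1 \<Longrightarrow> hat d = 0"
  by (simp add: hat_def)

text \<open>On the nonnegative half line \<open>hat\<close> is convex with second derivative at most
  2. The hypothesis on \<open>t\<close> keeps both shifted arguments there, away from the concave
  corner at 0.\<close>

lemma second_diff_hat_pos:
  assumes "\<bar>t\<bar> \<le> d" and "0 \<le> t"
  shows "0 \<le> hat (d + t) + hat (d - t) - 2 * hat d"
    and "hat (d + t) + hat (d - t) - 2 * hat d \<le> 2 * t\<^sup>2"
proof -
  have "\<bar>d + t\<bar> = d + t" "\<bar>d - t\<bar> = d - t" "\<bar>d\<bar> = d"
    using assms by auto
  then have eq: "hat (d + t) + hat (d - t) - 2 * hat d =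
      (max 0 (1 - d - t))\<^sup>2 + (max 0 (1 - d + t))\<^sup>2 - 2 * (max 0 (1 - d))\<^sup>2"
    by (simp add: hat_def algebra_simps)
  define e where "e = 1 - d"
  have *: "0 \<le> (max 0 (e - t))\<^sup>2 + (max 0 (e + t))\<^sup>2 - 2 * (max 0 e)\<^sup>2 \<and>
    (max 0 (e - t))\<^sup>2 + (max 0 (e + t))\<^sup>2 - 2 * (max 0 e)\<^sup>2 \<le> 2 * t\<^sup>2"
  proof (cases "e - t \<ge> 0")
    case True
    then show ?thesis using assms by (simp add: power2_eq_square algebra_simps)
  next
    case F: False
    show ?thesis
    proof (cases "e \<ge> 0")
      case True
      have m: "max 0 (e - t) = 0" "max 0 (e + t) = e + t" "max 0 e = e"
        using F True assms by auto
      have eq: "(max 0 (e - t))\<^sup>2 + (max 0 (e + t))\<^sup>2 - 2 * (max 0 e)\<^sup>2 = t * t + 2 * (e * t) - e * e"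
        unfolding m by (simp add: power2_eq_square algebra_simps)
      have "e * e \<le> e * t" using True F by (intro mult_left_mono) auto
      moreover have "t * t + 2 * (e * t) - e * e = 2 * t\<^sup>2 - (t - e)\<^sup>2"
        by (simp add: power2_eq_square algebra_simps)
      moreover have "0 \<le> (t - e)\<^sup>2" "0 \<le> e * e" "0 \<le> t * t" by simp_all
      ultimately show ?thesis unfolding eq by linarith
    next
      case False
      have "(max 0 (e + t))\<^sup>2 \<le> t\<^sup>2" using False assms by (intro power_mono) auto
      then show ?thesis using F False by (simp add: max_def) (smt (verit) zero_le_power2)
    qed
  qed
  show "0 \<le> hat (d + t) + hat (d - t) - 2 * hat d"
    "hat (d + t) + hat (d - t) - 2 * hat d \<le> 2 * t\<^sup>2"
    using * unfolding eq e_def by simp_all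
qed

lemma second_diff_hat:
  assumes "\<bar>t\<bar> \<le> \<bar>d\<bar>"
  shows "0 \<le> hat (d + t) + hat (d - t) - 2 * hat d"
    and "hat (d + t) + hat (d - t) - 2 * hat d \<le> 2 * t\<^sup>2"
proof -
  have eq: "hat (d + t) + hat (d - t) = hat (\<bar>d\<bar> + \<bar>t\<bar>) + hat (\<bar>d\<bar> - \<bar>t\<bar>)"
    using hat_minus[of "d + t"] hat_minus[of "d - t"]
    by (cases "d \<ge> 0"; cases "t \<ge> 0") (simp_all add: algebra_simps)
  have "hat \<bar>d\<bar> = hat d" by (simp add: hat_def)
  with second_diff_hat_pos[of "\<bar>t\<bar>" "\<bar>d\<bar>"] assms eq
  show "0 \<le> hat (d + t) + hat (d - t) - 2 * hat d"
    "hat (d + t) + hat (d - t) - 2 * hat d \<le> 2 * t\<^sup>2" by simp_all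
qed

text \<open>Neither 0 nor distance 1 is crossed, so \<open>hat\<close> is a single parabola here.
  With \<open>second_diff_hat_far\<close> this makes the second variation exact and not merely
  bounded.\<close>

lemma second_diff_hat_near:
  assumes "\<bar>t\<bar> \<le> \<bar>d\<bar>" "\<bar>d\<bar> + \<bar>t\<bar> \<le> 1"
  shows "hat (d + t) + hat (d - t) - 2 * hat d = 2 * t\<^sup>2"
proof (cases "d \<ge> 0")
  case True
  then have "\<bar>d + t\<bar> = d + t" "\<bar>d - t\<bar> = d - t" "\<bar>d\<bar> = d" using assms by auto
  then show ?thesis using assms by (simp add: hat_def power2_eq_square algebra_simps)
next
  case False
  then have "\<bar>d + t\<bar> = - d - t" "\<bar>d - t\<bar> = t - d" "\<bar>d\<bar> = - d" using assms by auto
  then show ?thesis using assms by (simp add: hat_def power2_eq_square algebra_simps)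
qed

lemma second_diff_hat_far:
  assumes "\<bar>d\<bar> - \<bar>t\<bar> \<ge> 1"
  shows "hat (d + t) + hat (d - t) - 2 * hat d = 0"
proof -
  have "\<bar>d + t\<bar> \<ge> 1" "\<bar>d - t\<bar> \<ge> 1" "\<bar>d\<bar> \<ge> 1" using assms by linarith+
  then show ?thesis by (simp add: hat_eq_0)
qed

text \<open>As long as 0 is not crossed, the absolute value term is convex; the square contributes
  exactly \<open>2 * t\<^sup>2\<close>.\<close>

lemma second_diff_kink:
  assumes "\<bar>t\<bar> \<le> \<bar>d\<bar>"
  shows "kink (d + t) + kink (d - t) - 2 * kink d \<ge> 2 * t\<^sup>2"
proof -
  have "\<bar>d + t\<bar> + \<bar>d - t\<bar> = 2 * \<bar>d\<bar>" using assms by linarith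
  then have "\<bar>\<bar>d + t\<bar> - 1\<bar> + \<bar>\<bar>d - t\<bar> - 1\<bar> \<ge> 2 * \<bar>\<bar>d\<bar> - 1\<bar>"
  proof -
    have "(\<bar>d + t\<bar> - 1) + (\<bar>d - t\<bar> - 1) = 2 * (\<bar>d\<bar> - 1)"
      using \<open>\<bar>d + t\<bar> + \<bar>d - t\<bar> = 2 * \<bar>d\<bar>\<close> by simp
    then have "2 * \<bar>\<bar>d\<bar> - 1\<bar> = \<bar>(\<bar>d + t\<bar> - 1) + (\<bar>d - t\<bar> - 1)\<bar>"
      by (simp only: abs_mult)
    then show ?thesis by (metis abs_triangle_ineq)
  qed
  then show ?thesis by (simp add: kink_def power2_eq_square algebra_simps)
qed

text \<open>The corner contributes to first order in \<open>t\<close>, which for small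
  \<open>t\<close> dominates the quadratic second differences of \<open>hat\<close>.\<close>

lemma second_diff_kink_at_1:
  assumes "\<bar>d\<bar> = 1" "\<bar>t\<bar> \<le> 1"
  shows "kink (d + t) + kink (d - t) - 2 * kink d \<ge> 2 * \<bar>t\<bar>"
proof -
  have "\<bar>\<bar>d + t\<bar> - 1\<bar> + \<bar>\<bar>d - t\<bar> - 1\<bar> \<ge> 2 * \<bar>t\<bar>" using assms by linarith
  moreover have "(d + t)\<^sup>2 + (d - t)\<^sup>2 - 2 * d\<^sup>2 \<ge> 0"
    by (simp add: power2_eq_square algebra_simps)
  ultimately show ?thesis using assms by (simp add: kink_def)
qed

text \<open>The left side is minus the integral of the second derivative of \<open>hat\<close> over
  a rectangle with sides \<open>m\<close> and \<open>n\<close>, and that derivative is at most 2. It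
  bounds the mutual energy of two intervals of lengths \<open>m\<close> and \<open>n\<close> at
  distance \<open>u\<close>.\<close>

lemma mixed_diff_hat:
  assumes "0 \<le> u" "0 \<le> m" "0 \<le> n"
  shows "hat (u + m) - hat (u + m + n) - hat u + hat (u + n) \<ge> - 2 * m * n"
proof -
  define e where "e = 1 - u"
  have eq: "hat (u + m) - hat (u + m + n) - hat u + hat (u + n) =
    (max 0 (e - m))\<^sup>2 - (max 0 (e - m - n))\<^sup>2 - (max 0 e)\<^sup>2 + (max 0 (e - n))\<^sup>2"
    using assms by (simp add: hat_def e_def algebra_simps)
  have mn: "0 \<le> m * n" using assms by simp
  have "(max 0 (e - m))\<^sup>2 - (max 0 (e - m - n))\<^sup>2 - (max 0 e)\<^sup>2 + (max 0 (e - n))\<^sup>2 \<ge> - 2 * m * n"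
  proof (cases "e - m - n \<ge> 0")
    case True
    then show ?thesis using assms by (simp add: power2_eq_square algebra_simps)
  next
    case F: False
    consider "e < 0" | "0 \<le> e" "e \<le> m" "e \<le> n" | "0 \<le> e" "e > m" "e \<le> n" | "0 \<le> e" "e \<le> m" "e > n"
      | "0 \<le> e" "e > m" "e > n" by linarith
    then show ?thesis
    proof cases
      case 1 then show ?thesis using assms mn by (simp add: max_def)
    next
      case 2 
      have "e * e \<le> m * n" using 2 assms by (intro mult_mono) auto
      moreover have "max 0 (e - m) = 0" "max 0 (e - n) = 0" "max 0 e = e" "max 0 (e - m - n) = 0"
        using 2 F by auto
      ultimately have "(max 0 (e - m))\<^sup>2 - (max 0 (e - m - n))\<^sup>2 - (max 0 e)\<^sup>2 + (max 0 (e - n))\<^sup>2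
          \<ge> - (m * n)" by (simp add: power2_eq_square)
      with mn show ?thesis by linarith
    next
      case 3
      have "max 0 (e - m) = e - m" "max 0 (e - n) = 0" "max 0 e = e" "max 0 (e - m - n) = 0"
        using 3 F by auto
      then have "(max 0 (e - m))\<^sup>2 - (max 0 (e - m - n))\<^sup>2 - (max 0 e)\<^sup>2 + (max 0 (e - n))\<^sup>2
          = m\<^sup>2 + 2 * (m * (n - e)) - 2 * m * n" by (simp add: power2_eq_square algebra_simps)
      moreover have "0 \<le> m * (n - e)" using 3 assms by simp
      ultimately show ?thesis using zero_le_power2[of m] by linarith
    next
      case 4
      have "max 0 (e - m) = 0" "max 0 (e - n) = e - n" "max 0 e = e" "max 0 (e - m - n) = 0"
        using 4 F by auto
      then have "(max 0 (e - m))\<^sup>2 - (max 0 (e - m - n))\<^sup>2 - (max 0 e)\<^sup>2 + (max 0 (e - n))\<^sup>2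
          = n\<^sup>2 + 2 * (n * (m - e)) - 2 * m * n" by (simp add: power2_eq_square algebra_simps)
      moreover have "0 \<le> n * (m - e)" using 4 assms by simp
      ultimately show ?thesis using zero_le_power2[of n] by linarith
    next
      case 5
      have "0 \<le> (e - m - n)\<^sup>2" by simp
      then show ?thesis using 5 mn F by (simp add: max_def power2_eq_square algebra_simps) 
    qed
  qed
  then show ?thesis unfolding eq .
qed

section \<open>The energy of an alternating sequence of endpoints\<close>

text \<open>
  For endpoints \<open>P 0 \<le> \<dots> \<le> P (n-1)\<close> of alternating runs inside and outside of \<open>A\<close>, \<open>interaction n P\<close> is the
  measure of the pairs \<open>(x, y)\<close> in the plane with \<open>\<bar>x - y\<bar> \<le> 1\<close> exactly one of whose entries lies in \<open>A\<close>.
  If no run is longer than 1 and only neighbouring endpoints are closer than 1, then \<open>excess\<close> is the sum of the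
  squares \<open>(P (i+1) - P i - \<gamma> i)\<^sup>2\<close>. Thanks to \<open>(\<gamma> i)\<^sup>2 + (\<gamma> (i+1))\<^sup>2 = 1\<close>, deleting a run of length 0 does
  not increase it.
\<close>

definition interaction :: "nat \<Rightarrow> (nat \<Rightarrow> real) \<Rightarrow> real" where
  "interaction n P = (\<Sum>i<n. \<Sum>j<n. (-1)^(i+j) * hat (P i - P j))"

definition runs :: "(nat \<Rightarrow> real) \<Rightarrow> nat \<Rightarrow> (nat \<Rightarrow> real) \<Rightarrow> real" where
  "runs \<gamma> n P = (\<Sum>i<n-1. 2 * (1 - \<gamma> i) * (P (Suc i) - P i) - 1 + (\<gamma> i)\<^sup>2)"

definition excess :: "(nat \<Rightarrow> real) \<Rightarrow> nat \<Rightarrow> (nat \<Rightarrow> real) \<Rightarrow> real" where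
  "excess \<gamma> n P = runs \<gamma> n P - (interaction n P - real n) / 2"

definition alternating :: "(nat \<Rightarrow> real) \<Rightarrow> bool" where
  "alternating \<gamma> \<longleftrightarrow> (\<forall>i. 0 \<le> \<gamma> i \<and> (\<gamma> i)\<^sup>2 + (\<gamma> (Suc i))\<^sup>2 = 1)"

section \<open>Weights and the removal of degenerate runs\<close>

lemma alternating_shift: "alternating \<gamma> \<Longrightarrow> alternating (\<lambda>i. \<gamma> (k + i))"
  by (simp add: alternating_def)

lemma alternating_add2: "alternating \<gamma> \<Longrightarrow> \<gamma> (Suc (Suc i)) = \<gamma> i"
proof -
  assume a: "alternating \<gamma>"
  then have "(\<gamma> (Suc (Suc i)))\<^sup>2 = (\<gamma> i)\<^sup>2" unfolding alternating_def by (smt (verit))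
  with a show ?thesis unfolding alternating_def by (metis power2_eq_iff_nonneg)
qed

lemma alternating_le_1: "alternating \<gamma> \<Longrightarrow> \<gamma> i \<le> 1"
proof -
  assume a: "alternating \<gamma>"
  then have "(\<gamma> i)\<^sup>2 \<le> 1\<^sup>2" unfolding alternating_def by (smt (verit) zero_le_power2 one_power2)
  then show ?thesis by (rule power2_le_imp_le) simp
qed

lemma sum_lessThan_add:
  fixes f :: "nat \<Rightarrow> 'a::comm_monoid_add"
  shows "(\<Sum>i<a+b. f i) = (\<Sum>i<a. f i) + (\<Sum>i<b. f (a+i))"
  by (induction b) (simp_all add: add.assoc)

text \<open>Neighbouring terms carry opposite signs, so equal values cancel; skipping two indices
  preserves all other signs.\<close>

lemma alternating_sum_cancel:
  fixes h :: "nat \<Rightarrow> real"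
  assumes "h q = h (Suc q)"
  shows "(\<Sum>i<q+2+r. (-1)^i * h i) = (\<Sum>i<q+r. (-1)^i * h (if i < q then i else i + 2))"
proof -
  have "(\<Sum>i<q+2+r. (-1)^i * h i) =
      (\<Sum>i<q. (-1)^i * h i) + (\<Sum>i<2. (-1)^(q+i) * h (q+i)) + (\<Sum>i<r. (-1)^(q+2+i) * h (q+2+i))"
    by (simp only: sum_lessThan_add)
  also have "(\<Sum>i<2. (-1)^(q+i) * h (q+i)) = 0"
    using assms by (simp add: numeral_2_eq_2)
  also have "(\<Sum>i<q. (-1)^i * h i) = (\<Sum>i<q. (-1)^i * h (if i < q then i else i + 2))" by simp
  also have "(\<Sum>i<r. (-1)^(q+2+i) * h (q+2+i)) =
      (\<Sum>i<r. (-1)^(q+i) * h (if q + i < q then q+i else q + i + 2))" 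
    by (simp add: power_add add_ac)
  finally show ?thesis by (simp only: sum_lessThan_add add_0_right)
qed

lemma interaction_nested: "interaction n P = (\<Sum>i<n. (-1)^i * (\<Sum>j<n. (-1)^j * hat (P i - P j)))"
  by (simp add: interaction_def power_add sum_distrib_left mult.assoc)

lemma interaction_delete:
  assumes "P q = P (Suc q)"
  shows "interaction (q+2+r) P = interaction (q+r) (\<lambda>i. P (if i < q then i else i + 2))"
proof -
  have inner: "(\<Sum>j<q+2+r. (-1)^j * hat (x - P j)) =
      (\<Sum>j<q+r. (-1)^j * hat (x - P (if j < q then j else j + 2)))" for x
    using alternating_sum_cancel[of "\<lambda>j. hat (x - P j)" q r] assms by simp
  have "interaction (q+2+r) P = (\<Sum>i<q+2+r. (-1)^i * (\<Sum>j<q+2+r. (-1)^j * hat (P i - P j)))"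
    by (rule interaction_nested)
  also have "\<dots> = (\<Sum>i<q+2+r. (-1)^i * (\<Sum>j<q+r. (-1)^j * hat (P i - P (if j < q then j else j + 2))))"
    by (simp only: inner)
  also have "\<dots> = (\<Sum>i<q+r. (-1)^i * (\<Sum>j<q+r. (-1)^j *
      hat (P (if i < q then i else i + 2) - P (if j < q then j else j + 2))))"
    using alternating_sum_cancel[of "\<lambda>i. \<Sum>j<q+r. (-1)^j * hat (P i - P (if j < q then j else j + 2))" q r]
      assms by simp
  also have "\<dots> = interaction (q+r) (\<lambda>i. P (if i < q then i else i + 2))"
    by (rule interaction_nested[symmetric])
  finally show ?thesis .
qed

text \<open>The two neighbours of the empty run have equal weights, since \<open>\<gamma>\<close>
  has period 2, and merge with it into one run; the constants change by exactly -1 because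
  consecutive squared weights add up to 1. At either end of the sequence there is only one
  neighbour, which is dropped together with its nonnegative length term.\<close>

lemma runs_delete:
  assumes alt: "alternating \<gamma>" and mono: "\<And>i. Suc i < q+2+r \<Longrightarrow> P i \<le> P (Suc i)"
    and eq: "P q = P (Suc q)" and pos: "0 < q + r"
  shows "runs \<gamma> (q+2+r) P \<ge> runs \<gamma> (q+r) (\<lambda>i. P (if i < q then i else i + 2)) - 1"
proof -
  define G where "G i = 2 * (1 - \<gamma> i) * (P (Suc i) - P i) - 1 + (\<gamma> i)\<^sup>2" for i
  have g2: "\<gamma> (Suc (Suc i)) = \<gamma> i" for i using alternating_add2[OF alt] .
  have gq: "(\<gamma> i)\<^sup>2 + (\<gamma> (Suc i))\<^sup>2 = 1" for i using alt by (simp add: alternating_def)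
  have nn: "2 * (1 - \<gamma> i) * (P (Suc i) - P i) \<ge> 0" if "Suc i < q+2+r" for i
    using alternating_le_1[OF alt, of i] mono[OF that] by simp
  define P' where "P' i = P (if i < q then i else i + 2)" for i
  define G' where "G' i = 2 * (1 - \<gamma> i) * (P' (Suc i) - P' i) - 1 + (\<gamma> i)\<^sup>2" for i
  have R: "runs \<gamma> (q+2+r) P = (\<Sum>i<q+1+r. G i)" by (simp add: runs_def G_def)
  have R': "runs \<gamma> (q+r) (\<lambda>i. P (if i < q then i else i + 2)) = (\<Sum>i<q+r-1. G' i)"
    by (simp add: runs_def G'_def P'_def)
  have Gq: "G q = - 1 + (\<gamma> q)\<^sup>2" using eq by (simp add: G_def)
  have shift: "G' i = G (Suc (Suc i))" if "i \<ge> q" for i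
    using that by (simp add: G'_def G_def P'_def g2)
  have same: "G' i = G i" if "Suc i < q" for i
    using that by (simp add: G'_def G_def P'_def)
  have "(\<Sum>i<q+1+r. G i) \<ge> (\<Sum>i<q+r-1. G' i) - 1"
  proof (cases q)
    case 0
    then obtain r' where r: "r = Suc r'" using pos by (cases r) auto
    have "(\<Sum>i<2+r'. G i) = G 0 + G 1 + (\<Sum>i<r'. G (2+i))"
      unfolding sum_lessThan_add by (simp add: numeral_2_eq_2)
    moreover have "(\<Sum>i<r'. G (2+i)) = (\<Sum>i<r'. G' i)" using shift 0 by simp
    moreover have "G 0 + G 1 \<ge> -1"
    proof -
      have "G 0 = - 1 + (\<gamma> 0)\<^sup>2" using Gq 0 by simp
      moreover have "G 1 \<ge> - 1 + (\<gamma> 1)\<^sup>2" using nn[of 1] r by (simp add: G_def)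
      moreover have "(\<gamma> 0)\<^sup>2 + (\<gamma> 1)\<^sup>2 = 1" using gq[of 0] by simp
      ultimately show ?thesis by linarith
    qed
    moreover have "q + 1 + r = 2 + r'" "q + r - 1 = r'" using 0 r by auto
    ultimately show ?thesis by (simp only:)
  next
    case (Suc p)
    have s1: "(\<Sum>i<p. G i) = (\<Sum>i<p. G' i)" using same Suc by simp
    show ?thesis
    proof (cases r)
      case 0
      have "(\<Sum>i<q+1+r. G i) = (\<Sum>i<p. G i) + G p + G q" using Suc 0 by simp
      moreover have "G p + G q \<ge> -1"
      proof -
        have "G p \<ge> - 1 + (\<gamma> p)\<^sup>2" using nn[of p] Suc by (simp add: G_def)
        then show ?thesis using Gq gq[of p] Suc by simp
      qed
      ultimately show ?thesis using 0 Suc s1 by simp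
    next
      case r: (Suc r')
      have "(\<Sum>i<q+1+r. G i) = (\<Sum>i<p+3+r'. G i)" using Suc r by (simp add: eval_nat_numeral)
      also have "\<dots> = (\<Sum>i<p. G i) + (G p + G q + G (Suc q)) + (\<Sum>i<r'. G (p+3+i))"
        unfolding sum_lessThan_add using Suc by (simp add: eval_nat_numeral)
      also have "(\<Sum>i<r'. G (p+3+i)) = (\<Sum>i<r'. G' (p+1+i))"
        using shift Suc by (simp add: eval_nat_numeral)
      also have "G p + G q + G (Suc q) = G' p - 1"
        using Gq Suc gq[of p] eq by (simp add: G_def G'_def P'_def g2 algebra_simps)
      also have "(\<Sum>i<p. G i) + (G' p - 1) + (\<Sum>i<r'. G' (p+1+i)) = (\<Sum>i<p+1+r'. G' i) - 1"
        unfolding sum_lessThan_add s1 by simp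
      finally show ?thesis using Suc r by simp
    qed
  qed
  then show ?thesis unfolding R R' .
qed

text \<open>The loss of 1 in \<open>runs_delete\<close> is compensated by the term
  \<open>real n / 2\<close>, since two endpoints disappear.\<close>

lemma excess_delete:
  assumes alt: "alternating \<gamma>" and mono: "\<And>i. Suc i < q+2+r \<Longrightarrow> P i \<le> P (Suc i)"
    and eq: "P q = P (Suc q)"
  shows "excess \<gamma> (q+2+r) P \<ge> excess \<gamma> (q+r) (\<lambda>i. P (if i < q then i else i + 2))"
proof (cases "q + r = 0")
  case True
  \<comment> \<open>Two coinciding endpoints have excess \<open>(\<gamma> 0)\<^sup>2\<close>, and
    the empty sequence has excess 0.\<close>
  then have "q = 0" "r = 0" by auto
  with eq interaction_delete[of P q r, OF eq] show ?thesis
    by (simp add: excess_def runs_def interaction_def)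
next
  case False
  then have "runs \<gamma> (q+2+r) P \<ge> runs \<gamma> (q+r) (\<lambda>i. P (if i < q then i else i + 2)) - 1"
    by (intro runs_delete alt mono eq) auto
  then show ?thesis unfolding excess_def interaction_delete[of P q r, OF eq]
    by (simp add: field_simps)
qed

text \<open>Endpoints on different sides of a long run do not interact, and the run itself
  contributes at least \<open>(1 - \<gamma> q)\<^sup>2\<close>. The right part inherits shifted
  weights, so an induction that uses this has to let \<open>\<gamma>\<close> vary.\<close>

lemma excess_split:
  assumes alt: "alternating \<gamma>" and mono: "\<And>i. Suc i < Suc q + Suc r \<Longrightarrow> P i \<le> P (Suc i)"
    and gap: "P (Suc q) - P q \<ge> 1"
  shows "excess \<gamma> (Suc q + Suc r) P \<ge>
    excess \<gamma> (Suc q) P + excess (\<lambda>i. \<gamma> (Suc q + i)) (Suc r) (\<lambda>i. P (Suc q + i))"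
proof -
  have le: "P i \<le> P j" if "i \<le> j" "j < Suc q + Suc r" for i j
    using that by (induction j) (auto simp: le_Suc_eq intro: order_trans[OF _ mono])
  have far: "hat (P i - P (Suc q + j)) = 0" "hat (P (Suc q + j) - P i) = 0" if "i < Suc q" "j < Suc r" for i j
    using le[of i q] le[of "Suc q" "Suc q + j"] that gap by (auto intro!: hat_eq_0)
  have "interaction (Suc q + Suc r) P = interaction (Suc q) P + interaction (Suc r) (\<lambda>i. P (Suc q + i))"
  proof -
    have sgn: "(-1::real)^(Suc q + i + (Suc q + j)) = (-1)^(i+j)" for i j
      by (simp add: power_add flip: power_mult_distrib)
    have "interaction (Suc q + Suc r) P = 
      (\<Sum>i<Suc q. (\<Sum>j<Suc q. (-1)^(i+j) * hat (P i - P j)) + (\<Sum>j<Suc r. (-1)^(i+(Suc q+j)) * hat (P i - P (Suc q+j))))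
     + (\<Sum>i<Suc r. (\<Sum>j<Suc q. (-1)^(Suc q+i+j) * hat (P (Suc q+i) - P j)) + (\<Sum>j<Suc r. (-1)^(Suc q+i+(Suc q+j)) * hat (P (Suc q + i) - P (Suc q+j))))"
      unfolding interaction_def by (simp only: sum_lessThan_add)
    also have "\<dots> = (\<Sum>i<Suc q. (\<Sum>j<Suc q. (-1)^(i+j) * hat (P i - P j)) + 0)
     + (\<Sum>i<Suc r. 0 + (\<Sum>j<Suc r. (-1)^(i+j) * hat (P (Suc q + i) - P (Suc q+j))))"
      unfolding sgn using far by (intro arg_cong2[of _ _ _ _ "(+)"] sum.cong sum.neutral refl) auto
    also have "\<dots> = interaction (Suc q) P + interaction (Suc r) (\<lambda>i. P (Suc q + i))"
      by (simp only: interaction_def add_0_left add_0_right)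
    finally show ?thesis .
  qed
  moreover have "runs \<gamma> (Suc q + Suc r) P \<ge> runs \<gamma> (Suc q) P + runs (\<lambda>i. \<gamma> (Suc q + i)) (Suc r) (\<lambda>i. P (Suc q + i))"
  proof -
    have "runs \<gamma> (Suc q + Suc r) P = 
      (\<Sum>i<Suc q + r. 2 * (1 - \<gamma> i) * (P (Suc i) - P i) - 1 + (\<gamma> i)\<^sup>2)"
      by (simp add: runs_def)
    also have "\<dots> = runs \<gamma> (Suc q) P + (2 * (1 - \<gamma> q) * (P (Suc q) - P q) - 1 + (\<gamma> q)\<^sup>2)
       + runs (\<lambda>i. \<gamma> (Suc q + i)) (Suc r) (\<lambda>i. P (Suc q + i))"
      unfolding sum_lessThan_add by (simp add: runs_def)
    also have "2 * (1 - \<gamma> q) * (P (Suc q) - P q) - 1 + (\<gamma> q)\<^sup>2 \<ge> 2 * (1 - \<gamma> q) * 1 - 1 + (\<gamma> q)\<^sup>2"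
      using gap alternating_le_1[OF alt, of q] by (intro add_mono diff_mono mult_left_mono) auto
    moreover have "2 * (1 - \<gamma> q) * 1 - 1 + (\<gamma> q)\<^sup>2 = (1 - \<gamma> q)\<^sup>2"
      by (simp add: power2_eq_square algebra_simps)
    ultimately show ?thesis by (smt (verit) zero_le_power2)
  qed
  ultimately show ?thesis by (simp add: excess_def field_simps)
qed

section \<open>Minimisers of the penalised energy\<close>

definition penalized :: "real \<Rightarrow> (nat \<Rightarrow> real) \<Rightarrow> nat \<Rightarrow> (nat \<Rightarrow> real) \<Rightarrow> real" where
  "penalized \<eta> \<gamma> n P = excess \<gamma> n P - \<eta> * (\<Sum>i<n. \<Sum>j<n. kink (P i - P j))"

text \<open>Bounding the gaps by 1 makes the admissible positions compact up to translation; longer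
  gaps are left to \<open>excess_split\<close>.\<close>

definition short_gaps :: "nat \<Rightarrow> (nat \<Rightarrow> real) \<Rightarrow> bool" where
  "short_gaps n P \<longleftrightarrow> (\<forall>i. Suc i < n \<longrightarrow> P i \<le> P (Suc i) \<and> P (Suc i) \<le> P i + 1)"

lemma penalized_cong:
  assumes "\<And>i. i < n \<Longrightarrow> P i = Q i"
  shows "penalized \<eta> \<gamma> n P = penalized \<eta> \<gamma> n Q"
proof -
  have "interaction n P = interaction n Q" using assms by (simp add: interaction_def)
  moreover have "runs \<gamma> n P = runs \<gamma> n Q" using assms by (simp add: runs_def)
  ultimately show ?thesis using assms by (simp add: penalized_def excess_def)
qed

lemma penalized_translate: "penalized \<eta> \<gamma> n (\<lambda>i. P i - c) = penalized \<eta> \<gamma> n P"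
  by (simp add: penalized_def excess_def interaction_def runs_def)

lemma short_gaps_bounds:
  assumes "short_gaps n P" "i < n"
  shows "P 0 \<le> P i" "P i \<le> P 0 + real i"
  using assms(2) by (induction i) (use assms(1) in \<open>force simp: short_gaps_def\<close>)+

lemma penalized_continuous: "continuous_on UNIV (penalized \<eta> \<gamma> n)"
proof -
  have [continuous_intros]: "continuous_on UNIV (\<lambda>P::nat \<Rightarrow> real. P i)" for i by simp
  show ?thesis
    unfolding penalized_def excess_def interaction_def runs_def hat_def kink_def
    by (intro continuous_intros) auto
qed

text \<open>The energy is translation invariant and depends only on the first \<open>n\<close>
  coordinates, so every competitor can be moved into a box, which is compact by Tychonoff's
  theorem.\<close>

lemma penalized_attains_min:
  "\<exists>P. short_gaps n P \<and> (\<forall>Q. short_gaps n Q \<longrightarrow> penalized \<eta> \<gamma> n P \<le> penalized \<eta> \<gamma> n Q)"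
proof -
  define K where "K = PiE UNIV (\<lambda>_::nat. {0..real n})"
  define S where "S = {P. short_gaps n P}"
  have "compactin euclidean K"
    unfolding K_def euclidean_product_topology[symmetric] compactin_PiE by simp
  then have "compact K" by simp
  moreover have "closed S"
  proof -
    have [continuous_intros]: "continuous_on UNIV (\<lambda>P::nat \<Rightarrow> real. P i)" for i by simp
    show ?thesis unfolding S_def short_gaps_def
      by (intro closed_Collect_all closed_Collect_imp closed_Collect_conj closed_Collect_le continuous_intros) auto
  qed
  ultimately have "compact (K \<inter> S)" by (rule compact_Int_closed)
  moreover have "(\<lambda>_. 0) \<in> K \<inter> S" by (auto simp: K_def S_def short_gaps_def)
  then have "K \<inter> S \<noteq> {}" by blast
  moreover have "continuous_on (K \<inter> S) (penalized \<eta> \<gamma> n)"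
    using penalized_continuous continuous_on_subset by blast
  ultimately obtain P where P: "P \<in> K \<inter> S" "\<And>Q. Q \<in> K \<inter> S \<Longrightarrow> penalized \<eta> \<gamma> n P \<le> penalized \<eta> \<gamma> n Q"
    by (metis continuous_attains_inf)
  have "penalized \<eta> \<gamma> n P \<le> penalized \<eta> \<gamma> n Q" if Q: "short_gaps n Q" for Q
  proof -
    define Q' where "Q' i = (if i < n then Q i - Q 0 else 0)" for i
    have "0 \<le> Q' i \<and> Q' i \<le> real n" for i
      using short_gaps_bounds[OF Q, of i] by (auto simp: Q'_def)
    then have "Q' \<in> K \<inter> S" using Q by (auto simp: K_def S_def short_gaps_def Q'_def)
    then have "penalized \<eta> \<gamma> n P \<le> penalized \<eta> \<gamma> n Q'" by (rule P)
    also have "\<dots> = penalized \<eta> \<gamma> n (\<lambda>i. Q i - Q 0)" by (rule penalized_cong) (simp add: Q'_def)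
    finally show ?thesis by (simp add: penalized_translate)
  qed
  then show ?thesis using P by (auto simp: S_def)
qed

section \<open>Excluding three endpoints in a short window\<close>

lemma alternating_sum_interval:
  "l \<le> Suc r \<Longrightarrow> (\<Sum>j=l..r. (-1::real)^j) = (if even (Suc r - l) then 0 else (-1)^l)"
proof (induction "Suc r - l" arbitrary: r)
  case 0
  then show ?case by simp
next
  case (Suc k)
  show ?case
  proof (cases "k = 0")
    case True
    with Suc.hyps(2) have "l = r" by simp
    then show ?thesis by simp
  next
    case False
    then obtain r' where r: "r = Suc r'" "l \<le> Suc r'" using Suc.hyps(2) by (cases r) auto
    have "(\<Sum>j=l..r. (-1::real)^j) = (\<Sum>j=l..r'. (-1)^j) + (-1)^r" using r by simp
    also have "(\<Sum>j=l..r'. (-1::real)^j) = (if even (Suc r' - l) then 0 else (-1)^l)"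
      using Suc.hyps r by (intro Suc.hyps) auto
    also have "\<dots> + (-1)^r = (if even (Suc r - l) then 0 else (-1)^l)"
    proof -
      have "(-1::real)^r = (-1)^(Suc r' - l) * (-1)^l" using r by (simp flip: power_add)
      then show ?thesis using r by (auto simp: Suc_diff_le)
    qed
    finally show ?thesis .
  qed
qed

text \<open>
  The hypothesis \<open>neg\<close> is the strict second order condition at a minimiser. With \<open>g i = (-1)^i * d i\<close>
  it reads \<open>\<Sum>B i * (d i)\<^sup>2 < \<Sum>a i j * d i * d j\<close>, where \<open>B i \<in> {-1, 0, 1}\<close> only depends on the parities of the
  numbers of endpoints at distance less than 1 to the left and to the right of \<open>P i\<close>. At the last \<open>m\<close> with
  \<open>P (m+2) - P m < 1\<close>, whose leftmost close endpoint is \<open>l\<close>, the test vectors \<open>d\<close> supported on \<open>{m}\<close>, \<open>{m, m+1}\<close> and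
  \<open>{l, m, m+1}\<close>, with values \<open>1\<close>, \<open>(1, -1)\<close> and \<open>(1, -2, 1)\<close>, are contradictory.
\<close>

lemma no_close_triple:
  fixes P :: "nat \<Rightarrow> real"
  assumes mono: "\<And>i j. i \<le> j \<Longrightarrow> j < n \<Longrightarrow> P i \<le> P j"
    and neg: "\<And>g :: nat \<Rightarrow> real. \<exists>i<n. \<exists>j<n. g i \<noteq> g j \<Longrightarrow>
      (\<Sum>i<n. \<Sum>j<n. (-1)^(i+j) * of_bool (\<bar>P i - P j\<bar> < 1) * (g i - g j)\<^sup>2) < 0"
    and "p + 2 < n"
  shows "P (p+2) - P p \<ge> 1"
proof (rule ccontr)
  define a :: "nat \<Rightarrow> nat \<Rightarrow> real" where "a i j = of_bool (\<bar>P i - P j\<bar> < 1)" for i j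
  define B where "B i = (\<Sum>j<n. (-1)^(i+j) * a i j)" for i
  have a_sym: "a i j = a j i" for i j by (simp add: a_def abs_minus_commute)
  have a_refl: "a i i = 1" for i by (simp add: a_def)
  \<comment> \<open>The substitution \<open>g i = (-1)^i * d i\<close> is expanded here. An index
    \<open>z\<close> outside the support guarantees that \<open>g\<close> is not constant, as
    \<open>neg\<close> demands.\<close>
  have quad: "(\<Sum>i\<in>V. B i * (d i)\<^sup>2) < (\<Sum>i\<in>V. \<Sum>j\<in>V. a i j * d i * d j)"
    if V: "V \<subseteq> {..<n}" and z: "z < n" "z \<notin> V" and v: "v \<in> V" "d v \<noteq> 0" for V d z v
  proof -
    define d' where "d' i = (if i \<in> V then d i else 0)" for i
    define g where "g i = (-1)^i * d' i" for i
    have sgn: "(-1::real)^i * (-1)^i = 1" for i by (simp flip: power_mult_distrib)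
    have "(\<Sum>i<n. \<Sum>j<n. (-1)^(i+j) * a i j * (g i - g j)\<^sup>2) < 0"
      unfolding a_def
    proof (rule neg)
      have "g z = 0" "g v \<noteq> 0" "v < n" using that by (auto simp: g_def d'_def)
      then show "\<exists>i<n. \<exists>j<n. g i \<noteq> g j" using z by metis
    qed
    also have "(\<Sum>i<n. \<Sum>j<n. (-1)^(i+j) * a i j * (g i - g j)\<^sup>2) =
       (\<Sum>i<n. \<Sum>j<n. (-1)^(i+j) * a i j * (d' i)\<^sup>2) + (\<Sum>i<n. \<Sum>j<n. (-1)^(i+j) * a i j * (d' j)\<^sup>2)
       - 2 * (\<Sum>i<n. \<Sum>j<n. a i j * d' i * d' j)"
    proof -
      have "(-1)^(i+j) * a i j * (g i - g j)\<^sup>2 = (-1)^(i+j) * a i j * (d' i)\<^sup>2 + 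
        (-1)^(i+j) * a i j * (d' j)\<^sup>2 - 2 * (a i j * d' i * d' j)" for i j
      proof -
        have "(g i - g j)\<^sup>2 = (d' i)\<^sup>2 + (d' j)\<^sup>2 - 2 * ((-1)^(i+j) * d' i * d' j)"
          by (simp add: g_def power2_eq_square algebra_simps power_add)
        moreover define s :: real where "s = (-1)^(i+j)"
        moreover have "s * s = 1" unfolding s_def by (rule sgn)
        then have "s * a i j * ((d' i)\<^sup>2 + (d' j)\<^sup>2 - 2 * (s * d' i * d' j)) =
            s * a i j * (d' i)\<^sup>2 + s * a i j * (d' j)\<^sup>2 - 2 * (a i j * d' i * d' j)"
          by algebra
        ultimately show ?thesis by simp
      qed
      then show ?thesis by (simp add: sum.distrib sum_subtractf sum_distrib_left)
    qed
    also have "(\<Sum>i<n. \<Sum>j<n. (-1)^(i+j) * a i j * (d' j)\<^sup>2) = (\<Sum>j<n. \<Sum>i<n. (-1)^(j+i) * a j i * (d' j)\<^sup>2)"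
      by (subst sum.swap) (simp add: a_sym add.commute)
    also have "(\<Sum>i<n. \<Sum>j<n. (-1)^(i+j) * a i j * (d' i)\<^sup>2) = (\<Sum>i<n. B i * (d' i)\<^sup>2)"
      by (simp add: B_def sum_distrib_right)
    also have "(\<Sum>i<n. B i * (d' i)\<^sup>2) = (\<Sum>i\<in>V. B i * (d i)\<^sup>2)"
      using V by (intro sum.mono_neutral_cong_right) (auto simp: d'_def)
    also have "(\<Sum>i<n. \<Sum>j<n. a i j * d' i * d' j) = (\<Sum>i\<in>V. \<Sum>j\<in>V. a i j * d i * d j)"
      using V by (intro sum.mono_neutral_cong_right) (auto simp: d'_def intro!: sum.mono_neutral_cong_right sum.neutral)
    finally show ?thesis by simp
  qed
  \<comment> \<open>By monotonicity the endpoints close to \<open>P i\<close> have consecutive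
    indices, so \<open>B i\<close> is an alternating sum over an interval.\<close>
  have nbrs: "\<exists>l r. l \<le> i \<and> i \<le> r \<and> r < n \<and> (\<forall>j<n. \<bar>P i - P j\<bar> < 1 \<longleftrightarrow> l \<le> j \<and> j \<le> r)" if "i < n" for i
  proof -
    define N where "N = {j. j < n \<and> \<bar>P i - P j\<bar> < 1}"
    have fin: "finite N" "i \<in> N" using that by (auto simp: N_def)
    then have mem: "Min N \<in> N" "Max N \<in> N" by (auto intro: Min_in Max_in)
    have "\<bar>P i - P j\<bar> < 1" if "j < n" "Min N \<le> j" "j \<le> Max N" for j
    proof -
      have "P (Min N) \<le> P j" "P j \<le> P (Max N)" using that mono mem by (auto simp: N_def)
      then show ?thesis using mem by (auto simp: N_def)
    qed
    moreover have "Min N \<le> j" "j \<le> Max N" if "j < n" "\<bar>P i - P j\<bar> < 1" for j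
      using that fin by (auto simp: N_def)
    moreover have "Min N \<le> i" "i \<le> Max N" "Max N < n" using fin mem by (auto simp: N_def)
    ultimately show ?thesis by blast
  qed
  have B_eq: "B i = (if even (Suc r - l) then 0 else (-1)^(i+l))" 
    if "l \<le> i" "i \<le> r" "r < n" "\<forall>j<n. \<bar>P i - P j\<bar> < 1 \<longleftrightarrow> l \<le> j \<and> j \<le> r" for i l r
  proof -
    have "B i = (\<Sum>j=l..r. (-1)^(i+j))"
      unfolding B_def a_def using that by (intro sum.mono_neutral_cong_right) auto
    also have "\<dots> = (-1)^i * (\<Sum>j=l..r. (-1)^j)" by (simp add: power_add sum_distrib_left)
    finally show ?thesis using that by (simp add: alternating_sum_interval power_add)
  qed
  have B_ge: "B i \<ge> -1" if "i < n" for i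
  proof -
    obtain l r where "l \<le> i" "i \<le> r" "r < n" "\<forall>j<n. \<bar>P i - P j\<bar> < 1 \<longleftrightarrow> l \<le> j \<and> j \<le> r"
      using nbrs[OF \<open>i < n\<close>] by blast
    from B_eq[OF this] show ?thesis by (simp add: minus_one_power_iff)
  qed
  assume "\<not> P (p+2) - P p \<ge> 1"
  with \<open>p + 2 < n\<close> have ex: "\<exists>p. p + 2 < n \<and> P (p+2) - P p < 1" by auto
  define m where "m = Max {p. p + 2 < n \<and> P (p+2) - P p < 1}"
  have fin: "finite {p. p + 2 < n \<and> P (p+2) - P p < 1}" by (rule finite_subset[of _ "{..<n}"]) auto
  have m: "m + 2 < n" "P (m+2) - P m < 1"
    using Max_in[OF fin] ex unfolding m_def by auto
  have m_max: "P (Suc m + 2) - P (Suc m) \<ge> 1" if "m + 3 < n"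
  proof (rule ccontr)
    assume "\<not> ?thesis"
    then have "Suc m \<le> m" unfolding m_def using that fin by (intro Max_ge) (auto simp: m_def)
    then show False by simp
  qed
  obtain l r where lr: "l \<le> m" "m \<le> r" "r < n" "\<forall>j<n. \<bar>P m - P j\<bar> < 1 \<longleftrightarrow> l \<le> j \<and> j \<le> r"
    using nbrs[of m] m by auto
  have "\<bar>P m - P (m+2)\<bar> < 1" using m mono[of m "m+2"] by auto
  then have "r \<ge> m + 2" using lr m by auto
  \<comment> \<open>Otherwise \<open>P (m+3)\<close> would be close to \<open>P m\<close>, hence to
    \<open>P (m+1)\<close>, against the maximality of \<open>m\<close>.\<close>
  moreover have "r < m + 3"
  proof (rule ccontr)
    assume "\<not> r < m + 3"
    then have "m + 3 < n" using lr by simp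
    then have "\<bar>P m - P (m+3)\<bar> < 1" using lr \<open>\<not> r < m + 3\<close> by auto
    moreover have "P m \<le> P (Suc m)" using mono[of m "Suc m"] m by auto
    ultimately show False using m_max \<open>m + 3 < n\<close> by (auto simp: numeral_3_eq_3 numeral_2_eq_2)
  qed
  ultimately have r: "r = m + 2" by simp
  have am: "a m (Suc m) = 1" "a (Suc m) m = 1" using lr m r unfolding a_sym[of "Suc m"] by (auto simp: a_def)
  \<comment> \<open>This excludes the value 1; as the block of \<open>m\<close> ends at
    \<open>m + 2\<close>, it fixes the parity of \<open>m - l\<close>.\<close>
  have "B m < 1" using quad[of "{m}" "m+2" m "\<lambda>_. 1"] m by (simp add: a_refl)
  with B_eq[OF lr] have odd: "odd (m - l)" using r lr(1) by (auto split: if_splits simp: minus_one_power_iff)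
  then have Bm: "B m = 0" using B_eq[OF lr] r lr(1) by (auto simp: minus_one_power_iff)
  have Bm1: "B (Suc m) < 0"
    using quad[of "{m, Suc m}" "m+2" m "\<lambda>i. if i = m then 1 else -1"] m Bm am by (simp add: a_refl)
  have lm: "l < m" using odd lr(1) by (cases "l = m") auto
  \<comment> \<open>If \<open>l\<close> were close to \<open>Suc m\<close> as well, the block of
    \<open>Suc m\<close> would also start at \<open>l\<close>, and the parity would make
    \<open>B (Suc m)\<close> nonnegative.\<close>
  have "a l (Suc m) = 0"
  proof (rule ccontr)
    assume "a l (Suc m) \<noteq> 0"
    then have c: "\<bar>P (Suc m) - P l\<bar> < 1" by (auto simp: a_def abs_minus_commute)
    obtain l' r' where lr': "l' \<le> Suc m" "Suc m \<le> r'" "r' < n" "\<forall>j<n. \<bar>P (Suc m) - P j\<bar> < 1 \<longleftrightarrow> l' \<le> j \<and> j \<le> r'"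
      using nbrs[of "Suc m"] m by auto
    have "l' \<le> l" using lr' c lm m by auto
    moreover have "l \<le> l'"
    proof -
      have "\<bar>P (Suc m) - P l'\<bar> < 1" using lr' by auto
      moreover have "P l' \<le> P m" "P m \<le> P (Suc m)" using \<open>l' \<le> l\<close> lm m by (auto intro!: mono)
      ultimately have "\<bar>P m - P l'\<bar> < 1" by auto
      moreover have "l' < n" using \<open>l' \<le> l\<close> lm m by simp
      ultimately show ?thesis using lr(4) by blast
    qed
    ultimately have "even (Suc m + l')" using odd lr(1) by (auto simp: even_diff_nat)
    then show False using B_eq[OF lr'] Bm1 by (auto split: if_splits)
  qed
  moreover have "a l m = 1" using lr lm m unfolding a_sym[of l] by (auto simp: a_def)
  moreover have "a m l = a l m" "a (Suc m) l = a l (Suc m)" by (rule a_sym)+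
  moreover have "(\<Sum>i\<in>{l, m, Suc m}. B i * (if i = m then -2 else 1)\<^sup>2) <
      (\<Sum>i\<in>{l, m, Suc m}. \<Sum>j\<in>{l, m, Suc m}. a i j * (if i = m then -2 else 1) * (if j = m then -2 else 1))"
    by (rule quad[of _ "m+2" m]) (use m lm in auto)
  moreover have "l \<noteq> m" "l \<noteq> Suc m" using lm by auto
  \<comment> \<open>For the values \<open>(1, -2, 1)\<close> the right-hand form is
    \<open>6 - 8\<close>, because \<open>l\<close> and \<open>Suc m\<close> are not close.\<close>
  ultimately have "B l + B (Suc m) < -2"
    using Bm am by (simp add: a_refl)
  with B_ge[of l] B_ge[of "Suc m"] lm m show False by simp
qed

section \<open>Second order conditions at an interior minimiser\<close>

lemma finite_positive_lower_bound:
  fixes F :: "real set"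
  assumes "finite F" "\<And>x. x \<in> F \<Longrightarrow> 0 < x"
  shows "\<exists>\<epsilon>>0. \<forall>x\<in>F. \<epsilon> \<le> x"
  using assms by (intro exI[of _ "Min (insert 1 F)"]) auto

text \<open>The run term is affine in the positions and drops out, leaving only the kernels.\<close>

lemma penalized_second_difference:
  "penalized \<eta> \<gamma> n (\<lambda>i. P i + x i) + penalized \<eta> \<gamma> n (\<lambda>i. P i - x i) - 2 * penalized \<eta> \<gamma> n P =
    (\<Sum>i<n. \<Sum>j<n.
      - ((-1)^(i+j) * (hat (P i - P j + (x i - x j)) + hat (P i - P j - (x i - x j)) - 2 * hat (P i - P j))) / 2
      - \<eta> * (kink (P i - P j + (x i - x j)) + kink (P i - P j - (x i - x j)) - 2 * kink (P i - P j)))"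
proof -
  have r: "runs \<gamma> n (\<lambda>i. P i + x i) + runs \<gamma> n (\<lambda>i. P i - x i) - 2 * runs \<gamma> n P = 0"
    unfolding runs_def sum_distrib_left sum.distrib[symmetric] sum_subtractf[symmetric]
    by (intro sum.neutral ballI) (simp add: algebra_simps)
  have i: "interaction n (\<lambda>i. P i + x i) + interaction n (\<lambda>i. P i - x i) - 2 * interaction n P =
     (\<Sum>i<n. \<Sum>j<n. (-1)^(i+j) * (hat (P i - P j + (x i - x j)) + hat (P i - P j - (x i - x j)) - 2 * hat (P i - P j)))"
    unfolding interaction_def sum_distrib_left sum.distrib[symmetric] sum_subtractf[symmetric]
    by (intro sum.cong refl) (simp add: algebra_simps)
  define k where "k P = (\<Sum>i<n. \<Sum>j<n. kink (P i - P j))" for P :: "nat \<Rightarrow> real"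
  have k: "k (\<lambda>i. P i + x i) + k (\<lambda>i. P i - x i) - 2 * k P =
     (\<Sum>i<n. \<Sum>j<n. kink (P i - P j + (x i - x j)) + kink (P i - P j - (x i - x j)) - 2 * kink (P i - P j))"
    unfolding k_def sum_distrib_left sum.distrib[symmetric] sum_subtractf[symmetric]
    by (intro sum.cong refl) (simp add: algebra_simps)
  have lin: "(\<Sum>i<n. \<Sum>j<n. - U i j / 2 - \<eta> * V i j) = - (\<Sum>i<n. \<Sum>j<n. U i j) / 2 - \<eta> * (\<Sum>i<n. \<Sum>j<n. V i j)"
    for U V :: "nat \<Rightarrow> nat \<Rightarrow> real"
    by (simp add: sum_subtractf sum_negf sum_divide_distrib sum_distrib_left)
  show ?thesis unfolding lin i[symmetric] k[symmetric]
    using r by (simp add: penalized_def excess_def k_def field_simps)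
qed

context
  fixes n :: nat and P \<gamma> :: "nat \<Rightarrow> real" and \<eta> :: real
  assumes gaps: "\<And>i. Suc i < n \<Longrightarrow> P i < P (Suc i) \<and> P (Suc i) < P i + 1"
    and minimal: "\<And>Q. short_gaps n Q \<Longrightarrow> penalized \<eta> \<gamma> n P \<le> penalized \<eta> \<gamma> n Q"
    and \<eta>: "0 < \<eta>"
begin

lemma minimizer_strict_mono: "i < j \<Longrightarrow> j < n \<Longrightarrow> P i < P j"
proof (induction j)
  case (Suc j)
  then show ?case using gaps[of j] by (cases "i = j") force+
qed simp

lemma minimizer_distinct: "i < n \<Longrightarrow> j < n \<Longrightarrow> i \<noteq> j \<Longrightarrow> 0 < \<bar>P i - P j\<bar>"
  using minimizer_strict_mono[of i j] minimizer_strict_mono[of j i] by (cases "i < j") auto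

text \<open>If \<open>\<epsilon>\<close> is at most every pairwise distance and every slack of a gap
  below 1, then \<open>P + x\<close> and \<open>P - x\<close> are both admissible, and their
  minimality inequalities are added.\<close>

lemma minimizer_small_moves:
  obtains \<epsilon> where "\<epsilon> > 0" "\<epsilon> \<le> 1" "\<And>i j. i < n \<Longrightarrow> j < n \<Longrightarrow> i \<noteq> j \<Longrightarrow> \<epsilon> \<le> \<bar>P i - P j\<bar>"
    "\<And>x. (\<And>i j. i < n \<Longrightarrow> j < n \<Longrightarrow> \<bar>x i - x j\<bar> \<le> \<epsilon>) \<Longrightarrow>
      0 \<le> penalized \<eta> \<gamma> n (\<lambda>i. P i + x i) + penalized \<eta> \<gamma> n (\<lambda>i. P i - x i) - 2 * penalized \<eta> \<gamma> n P"
proof -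
  define F where "F = (\<lambda>(i,j). \<bar>P i - P j\<bar>) ` ({(i,j). i \<noteq> j} \<inter> {..<n} \<times> {..<n}) \<union> (\<lambda>i. P i + 1 - P (Suc i)) ` {..<n-1}"
  have "\<exists>\<epsilon>>0. \<forall>x\<in>insert 1 F. \<epsilon> \<le> x"
    by (rule finite_positive_lower_bound) (use minimizer_distinct gaps in \<open>auto simp: F_def\<close>)
  then obtain \<epsilon> where \<epsilon>: "\<epsilon> > 0" "\<epsilon> \<le> 1" "\<And>x. x \<in> F \<Longrightarrow> \<epsilon> \<le> x" by auto
  have d: "\<epsilon> \<le> \<bar>P i - P j\<bar>" if "i < n" "j < n" "i \<noteq> j" for i j
    by (rule \<epsilon>) (use that in \<open>auto simp: F_def\<close>)
  have g: "\<epsilon> \<le> P i + 1 - P (Suc i)" if "Suc i < n" for i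
    by (rule \<epsilon>) (use that in \<open>auto simp: F_def\<close>)
  have ok: "short_gaps n (\<lambda>i. P i + x i)" if x: "\<forall>i<n. \<forall>j<n. \<bar>x i - x j\<bar> \<le> \<epsilon>" for x
    unfolding short_gaps_def
  proof (intro allI impI)
    fix i assume i: "Suc i < n"
    have "\<bar>x (Suc i) - x i\<bar> \<le> \<epsilon>" using x i by simp
    moreover have "\<epsilon> \<le> P (Suc i) - P i" using d[of i "Suc i"] gaps[OF i] i by simp
    ultimately show "P i + x i \<le> P (Suc i) + x (Suc i) \<and> P (Suc i) + x (Suc i) \<le> P i + x i + 1"
      using g[OF i] by (auto simp: abs_le_iff)
  qed
  show ?thesis
  proof (rule that[OF \<epsilon>(1,2) d])
    fix x :: "nat \<Rightarrow> real"
    assume x: "\<bar>x i - x j\<bar> \<le> \<epsilon>" if "i < n" "j < n" for i j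
    have "short_gaps n (\<lambda>i. P i + x i)" using x by (intro ok) blast
    moreover have "\<bar>- x i - - x j\<bar> \<le> \<epsilon>" if "i < n" "j < n" for i j
      using x[OF that] by linarith
    then have "short_gaps n (\<lambda>i. P i + - x i)" by (intro ok) blast
    ultimately show "0 \<le> penalized \<eta> \<gamma> n (\<lambda>i. P i + x i) + penalized \<eta> \<gamma> n (\<lambda>i. P i - x i) -
        2 * penalized \<eta> \<gamma> n P"
      using minimal[of "\<lambda>i. P i + x i"] minimal[of "\<lambda>i. P i + - x i"] by simp
  qed
qed

text \<open>Otherwise move one of the two endpoints by \<open>\<tau>\<close> both ways: the corner
  of \<open>kink\<close> lowers the second difference by \<open>2 * \<eta> * \<tau>\<close>, while
  all \<open>hat\<close> terms together raise it only quadratically in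
  \<open>\<tau>\<close>.\<close>

lemma minimizer_no_unit_distance:
  assumes "u < n" "v < n"
  shows "\<bar>P u - P v\<bar> \<noteq> 1"
proof
  assume uv: "\<bar>P u - P v\<bar> = 1"
  obtain \<epsilon> where \<epsilon>: "\<epsilon> > 0" "\<epsilon> \<le> 1" "\<And>i j. i < n \<Longrightarrow> j < n \<Longrightarrow> i \<noteq> j \<Longrightarrow> \<epsilon> \<le> \<bar>P i - P j\<bar>"
    and var: "\<And>x. (\<And>i j. i < n \<Longrightarrow> j < n \<Longrightarrow> \<bar>x i - x j\<bar> \<le> \<epsilon>) \<Longrightarrow>
      0 \<le> penalized \<eta> \<gamma> n (\<lambda>i. P i + x i) + penalized \<eta> \<gamma> n (\<lambda>i. P i - x i) - 2 * penalized \<eta> \<gamma> n P"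
    using minimizer_small_moves by metis
  \<comment> \<open>This choice bounds the quadratic error by \<open>\<eta> * \<tau>\<close>, half
    of the gain.\<close>
  define \<tau> where "\<tau> = min \<epsilon> (\<eta> / (real n * real n))"
  have n: "real n * real n > 0" using assms by simp
  have \<tau>: "0 < \<tau>" "\<tau> \<le> \<epsilon>" "real n * real n * \<tau> \<le> \<eta>"
    using \<epsilon> \<eta> n by (auto simp: \<tau>_def min_def field_simps)
  define x where "x i = (if i = u then \<tau> else 0)" for i
  have x: "\<bar>x i - x j\<bar> \<le> \<tau>" for i j using \<tau> by (auto simp: x_def)
  have "0 \<le> (\<Sum>i<n. \<Sum>j<n.
      - ((-1)^(i+j) * (hat (P i - P j + (x i - x j)) + hat (P i - P j - (x i - x j)) - 2 * hat (P i - P j))) / 2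
      - \<eta> * (kink (P i - P j + (x i - x j)) + kink (P i - P j - (x i - x j)) - 2 * kink (P i - P j)))"
    by (rule var[of x, unfolded penalized_second_difference]) (rule order_trans[OF x \<tau>(2)])
  also have "\<dots> \<le> (\<Sum>i<n. \<Sum>j<n. \<tau>\<^sup>2 - (if i = u \<and> j = v then 2 * \<eta> * \<tau> else 0))"
  proof (intro sum_mono)
    fix i j assume ij: "i \<in> {..<n}" "j \<in> {..<n}"
    let ?d = "P i - P j" and ?t = "x i - x j"
    have t: "\<bar>?t\<bar> \<le> \<bar>?d\<bar>" using ij x[of i j] \<tau> \<epsilon>(3)[of i j] by (cases "i = j") auto
    have h: "\<bar>hat (?d + ?t) + hat (?d - ?t) - 2 * hat ?d\<bar> \<le> 2 * ?t\<^sup>2"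
      using second_diff_hat[OF t] by simp
    have "\<bar>(-1)^(i+j) * (hat (?d + ?t) + hat (?d - ?t) - 2 * hat ?d)\<bar> \<le> 2 * ?t\<^sup>2"
      using h by (simp add: abs_mult)
    moreover have "?t\<^sup>2 \<le> \<tau>\<^sup>2" using x[of i j] \<tau> by (simp add: abs_le_square_iff[symmetric])
    moreover have "(if i = u \<and> j = v then 2 * \<tau> else 0) \<le> kink (?d + ?t) + kink (?d - ?t) - 2 * kink ?d"
    proof (cases "i = u \<and> j = v")
      case True
      have "u \<noteq> v" using uv by auto
      with True have "?t = \<tau>" by (simp add: x_def)
      then show ?thesis using second_diff_kink_at_1[of ?d ?t] True uv \<tau> \<epsilon> by simp
    next
      case False
      moreover have "0 \<le> 2 * ?t\<^sup>2" by simp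
      ultimately show ?thesis using order_trans[OF _ second_diff_kink[OF t]] by presburger
    qed
    then have "\<eta> * (if i = u \<and> j = v then 2 * \<tau> else 0) \<le> \<eta> * (kink (?d + ?t) + kink (?d - ?t) - 2 * kink ?d)"
      by (rule mult_left_mono) (use \<eta> in simp)
    moreover have "\<eta> * (if i = u \<and> j = v then 2 * \<tau> else 0) = (if i = u \<and> j = v then 2 * \<eta> * \<tau> else 0)"
      by simp
    ultimately show "- ((-1)^(i+j) * (hat (?d + ?t) + hat (?d - ?t) - 2 * hat ?d)) / 2
      - \<eta> * (kink (?d + ?t) + kink (?d - ?t) - 2 * kink ?d) \<le> \<tau>\<^sup>2 - (if i = u \<and> j = v then 2 * \<eta> * \<tau> else 0)"
      unfolding abs_le_iff by linarith
  qed
  also have "\<dots> = real n * real n * \<tau>\<^sup>2 - 2 * \<eta> * \<tau>"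
  proof -
    have "(\<Sum>i<n. \<Sum>j<n. if i = u \<and> j = v then 2 * \<eta> * \<tau> else 0) = (\<Sum>i<n. if i = u then 2 * \<eta> * \<tau> else 0)"
      using assms by (intro sum.cong) auto
    then show ?thesis using assms by (simp add: sum_subtractf)
  qed
  also have "\<dots> = (real n * real n * \<tau> - 2 * \<eta>) * \<tau>" by (simp add: power2_eq_square algebra_simps)
  also have "\<dots> < 0" using \<tau> \<eta> by (intro mult_neg_pos) auto
  finally show False by simp
qed

text \<open>Small multiples of \<open>g\<close> let no distance cross 0 or 1, so the second
  differences of \<open>hat\<close> are exact; the square in \<open>kink\<close> makes the
  inequality strict.\<close>

lemma minimizer_second_variation:
  assumes "\<exists>i<n. \<exists>j<n. g i \<noteq> g j"
  shows "(\<Sum>i<n. \<Sum>j<n. (-1)^(i+j) * of_bool (\<bar>P i - P j\<bar> < 1) * (g i - g j)\<^sup>2) < (0::real)"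
proof -
  obtain \<epsilon> where \<epsilon>: "\<epsilon> > 0" "\<And>i j. i < n \<Longrightarrow> j < n \<Longrightarrow> i \<noteq> j \<Longrightarrow> \<epsilon> \<le> \<bar>P i - P j\<bar>"
    and var: "\<And>x. (\<And>i j. i < n \<Longrightarrow> j < n \<Longrightarrow> \<bar>x i - x j\<bar> \<le> \<epsilon>) \<Longrightarrow>
      0 \<le> penalized \<eta> \<gamma> n (\<lambda>i. P i + x i) + penalized \<eta> \<gamma> n (\<lambda>i. P i - x i) - 2 * penalized \<eta> \<gamma> n P"
    using minimizer_small_moves by metis
  have "\<exists>\<delta>>0. \<forall>y\<in>(\<lambda>(i,j). \<bar>\<bar>P i - P j\<bar> - 1\<bar>) ` ({..<n} \<times> {..<n}). \<delta> \<le> y"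
    by (rule finite_positive_lower_bound) (use minimizer_no_unit_distance in auto)
  then obtain \<delta> where \<delta>: "\<delta> > 0" "\<And>i j. i < n \<Longrightarrow> j < n \<Longrightarrow> \<delta> \<le> \<bar>\<bar>P i - P j\<bar> - 1\<bar>" by auto
  define G where "G = 1 + (\<Sum>i<n. \<bar>g i\<bar>)"
  have G: "\<bar>g i - g j\<bar> \<le> 2 * G" if "i < n" "j < n" for i j
  proof -
    have "\<bar>g i\<bar> \<le> (\<Sum>i<n. \<bar>g i\<bar>)" "\<bar>g j\<bar> \<le> (\<Sum>i<n. \<bar>g i\<bar>)"
      using that by (auto intro!: member_le_sum)
    then show ?thesis by (simp add: G_def)
  qed
  have "G > 0" by (simp add: G_def add_pos_nonneg sum_nonneg)
  define \<tau> where "\<tau> = min \<epsilon> \<delta> / (2 * G)"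
  have \<tau>: "0 < \<tau>" using \<epsilon> \<delta> \<open>G > 0\<close> by (simp add: \<tau>_def)
  have t: "\<bar>\<tau> * g i - \<tau> * g j\<bar> \<le> \<epsilon> \<and> \<bar>\<tau> * g i - \<tau> * g j\<bar> \<le> \<delta>" if "i < n" "j < n" for i j
  proof -
    have "\<bar>\<tau> * g i - \<tau> * g j\<bar> = \<tau> * \<bar>g i - g j\<bar>"
      using \<tau> by (simp add: abs_mult flip: right_diff_distrib)
    also have "\<dots> \<le> \<tau> * (2 * G)" using G[OF that] \<tau> by (intro mult_left_mono) auto
    also have "\<dots> = min \<epsilon> \<delta>" using \<open>G > 0\<close> by (simp add: \<tau>_def)
    finally show ?thesis by simp
  qed
  define q where "q i j = (-1)^(i+j) * of_bool (\<bar>P i - P j\<bar> < 1) * (g i - g j)\<^sup>2" for i j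
  have "0 \<le> (\<Sum>i<n. \<Sum>j<n. - \<tau>\<^sup>2 * q i j - \<tau>\<^sup>2 * (2 * \<eta>) * (g i - g j)\<^sup>2)"
  proof (rule order_trans[OF var[of "\<lambda>i. \<tau> * g i", unfolded penalized_second_difference] sum_mono[OF sum_mono]])
    show "\<bar>\<tau> * g i - \<tau> * g j\<bar> \<le> \<epsilon>" if "i < n" "j < n" for i j using t that by blast
  next
    fix i j assume ij: "i \<in> {..<n}" "j \<in> {..<n}"
    let ?d = "P i - P j" and ?t = "\<tau> * g i - \<tau> * g j"
    have le: "\<bar>?t\<bar> \<le> \<bar>?d\<bar>" using ij t[of i j] \<epsilon>(2)[of i j] by (cases "i = j") auto
    have t2: "?t\<^sup>2 = \<tau>\<^sup>2 * (g i - g j)\<^sup>2"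
      by (simp flip: right_diff_distrib add: power_mult_distrib)
    have "hat (?d + ?t) + hat (?d - ?t) - 2 * hat ?d = of_bool (\<bar>?d\<bar> < 1) * 2 * ?t\<^sup>2"
    proof (cases "\<bar>?d\<bar> < 1")
      case True
      then show ?thesis using second_diff_hat_near[OF le] t[of i j] \<delta>(2)[of i j] ij by auto
    next
      case False
      then have "1 \<le> \<bar>?d\<bar> - \<bar>?t\<bar>" using t[of i j] \<delta>(2)[of i j] ij by auto
      then show ?thesis using second_diff_hat_far False by simp
    qed
    moreover have "\<eta> * (2 * ?t\<^sup>2) \<le> \<eta> * (kink (?d + ?t) + kink (?d - ?t) - 2 * kink ?d)"
      using second_diff_kink[OF le] \<eta> by (intro mult_left_mono) auto
    ultimately show "- ((-1)^(i+j) * (hat (?d + ?t) + hat (?d - ?t) - 2 * hat ?d)) / 2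
      - \<eta> * (kink (?d + ?t) + kink (?d - ?t) - 2 * kink ?d) \<le> - \<tau>\<^sup>2 * q i j - \<tau>\<^sup>2 * (2 * \<eta>) * (g i - g j)\<^sup>2"
      unfolding q_def t2 by (simp add: algebra_simps)
  qed
  also have "\<dots> = - \<tau>\<^sup>2 * ((\<Sum>i<n. \<Sum>j<n. q i j) + 2 * \<eta> * (\<Sum>i<n. \<Sum>j<n. (g i - g j)\<^sup>2))"
    unfolding sum_distrib_left distrib_left sum_subtractf sum_negf
    by (simp add: mult.assoc flip: sum_negf)
  finally have "(\<Sum>i<n. \<Sum>j<n. q i j) + 2 * \<eta> * (\<Sum>i<n. \<Sum>j<n. (g i - g j)\<^sup>2) \<le> 0"
    using \<tau> by (simp add: mult_le_0_iff)
  moreover have "(\<Sum>i<n. \<Sum>j<n. (g i - g j)\<^sup>2) > 0"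
  proof -
    obtain i j where ij: "i < n" "j < n" "g i \<noteq> g j" using assms by blast
    have "0 < (\<Sum>j<n. (g i - g j)\<^sup>2)" 
      by (rule sum_pos2[of _ j]) (use ij in auto)
    then show ?thesis using ij(1) sum_pos2[of "{..<n}" i "\<lambda>i. \<Sum>j<n. (g i - g j)\<^sup>2"] by (simp add: sum_nonneg)
  qed
  then have "2 * \<eta> * (\<Sum>i<n. \<Sum>j<n. (g i - g j)\<^sup>2) > 0" using \<eta> by simp
  ultimately show ?thesis unfolding q_def by linarith
qed

lemma minimizer_separated: "p + 2 < n \<Longrightarrow> P (p+2) - P p \<ge> 1"
  by (rule no_close_triple[of n P p])
    (use minimizer_second_variation minimizer_strict_mono in \<open>auto simp: le_less\<close>)

end

section \<open>Separated endpoints, and the inequality in general\<close>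

text \<open>A new last endpoint adds the diagonal term 1 and interacts only with its predecessor,
  all earlier ones being at distance at least 1.\<close>

lemma interaction_separated:
  assumes mono: "\<And>i j. i \<le> j \<Longrightarrow> j < n \<Longrightarrow> P i \<le> P j"
    and sep: "\<And>p. p + 2 < n \<Longrightarrow> P (p+2) - P p \<ge> 1"
  shows "interaction n P = real n - 2 * (\<Sum>i<n-1. hat (P (Suc i) - P i))"
  using assms
proof (induction n)
  case 0
  then show ?case by (simp add: interaction_def)
next
  case (Suc n)
  have IH: "interaction n P = real n - 2 * (\<Sum>i<n-1. hat (P (Suc i) - P i))"
    by (rule Suc.IH) (use Suc.prems in auto)
  have "interaction (Suc n) P = interaction n P + 1 + 2 * (\<Sum>i<n. (-1)^(i+n) * hat (P i - P n))"
  proof -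
    define t where "t i j = (-1)^(i+j) * hat (P i - P j)" for i j
    have "(\<Sum>j<n. t n j) = (\<Sum>j<n. t j n)"
      unfolding t_def by (intro sum.cong refl arg_cong2[of _ _ _ _ "(*)"] hat_minus_commute) (simp add: add.commute)
    moreover have "t n n = 1" by (simp add: t_def)
    ultimately show ?thesis unfolding interaction_def t_def[symmetric] by (simp add: sum.distrib)
  qed
  also have "(\<Sum>i<n. (-1)^(i+n) * hat (P i - P n)) = - (if n = 0 then 0 else hat (P n - P (n-1)))"
  proof (cases n)
    case (Suc m)
    have "hat (P i - P n) = 0" if "i < m" for i
    proof -
      have "P (m - 1 + 2) - P (m - 1) \<ge> 1" by (rule Suc.prems) (use that Suc in auto)
      moreover have "m - 1 + 2 = n" using that Suc by simp
      moreover have "P i \<le> P (m - 1)" by (rule Suc.prems) (use that Suc in auto)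
      ultimately show ?thesis by (intro hat_eq_0) simp
    qed
    then have "(\<Sum>i<m. (-1)^(i+n) * hat (P i - P n)) = 0" by (intro sum.neutral) auto
    then show ?thesis using Suc by (simp add: hat_minus_commute[of "P m" "P (Suc m)"])
  qed simp
  finally show ?case using IH by (cases n) auto
qed

lemma excess_separated:
  assumes "short_gaps n P" and sep: "\<And>p. p + 2 < n \<Longrightarrow> P (p+2) - P p \<ge> 1"
  shows "excess \<gamma> n P \<ge> 0"
proof -
  have mono: "P i \<le> P j" if "i \<le> j" "j < n" for i j
    using that by (induction j) (use assms(1) in \<open>force simp: short_gaps_def le_Suc_eq\<close>)+
  have "excess \<gamma> n P = (\<Sum>i<n-1. 2 * (1 - \<gamma> i) * (P (Suc i) - P i) - 1 + (\<gamma> i)\<^sup>2 + hat (P (Suc i) - P i))"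
  proof -
    have "interaction n P = real n - 2 * (\<Sum>i<n-1. hat (P (Suc i) - P i))"
      by (intro interaction_separated mono sep)
    then show ?thesis by (simp add: excess_def runs_def sum.distrib)
  qed
  also have "\<dots> = (\<Sum>i<n-1. (P (Suc i) - P i - \<gamma> i)\<^sup>2)"
  proof (rule sum.cong)
    fix i assume "i \<in> {..<n-1}"
    then have "0 \<le> P (Suc i) - P i" "P (Suc i) - P i \<le> 1"
      using assms(1) by (auto simp: short_gaps_def algebra_simps)
    then have "hat (P (Suc i) - P i) = (1 - (P (Suc i) - P i))\<^sup>2" by (simp add: hat_def)
    then show "2 * (1 - \<gamma> i) * (P (Suc i) - P i) - 1 + (\<gamma> i)\<^sup>2 + hat (P (Suc i) - P i) = (P (Suc i) - P i - \<gamma> i)\<^sup>2"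
      by (simp add: power2_eq_square algebra_simps)
  qed simp
  also have "\<dots> \<ge> 0" by (intro sum_nonneg) simp
  finally show ?thesis .
qed

text \<open>Strong induction on \<open>n\<close>. A minimiser of the penalised energy has a
  collision or a long gap, which leads to fewer endpoints, or it is separated; in each case its
  excess is nonnegative. Comparing with \<open>P\<close> and letting \<open>\<eta>\<close> tend to 0
  gives the claim.\<close>

theorem excess_nonneg:
  assumes "alternating \<gamma>" and "\<And>i. Suc i < n \<Longrightarrow> P i \<le> P (Suc i)"
  shows "excess \<gamma> n P \<ge> 0"
  using assms
proof (induction n arbitrary: \<gamma> P rule: less_induct)
  case (less n)
  note alt = \<open>alternating \<gamma>\<close>
  have degenerate: "excess \<gamma> n Q \<ge> 0"
    if mono: "\<And>i. Suc i < n \<Longrightarrow> Q i \<le> Q (Suc i)"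
      and q: "Suc q < n" "Q q = Q (Suc q) \<or> Q (Suc q) - Q q \<ge> 1" for Q q
    using q(2)
  proof
    assume eq: "Q q = Q (Suc q)"
    obtain r where r: "n = q + 2 + r" using q(1) by (auto dest!: less_imp_Suc_add)
    have "0 \<le> excess \<gamma> (q + r) (\<lambda>i. Q (if i < q then i else i + 2))"
    proof (rule less.IH[OF _ alt])
      fix i assume i: "Suc i < q + r"
      consider "Suc i < q" | "Suc i = q" | "q \<le> i" by linarith
      then show "Q (if i < q then i else i + 2) \<le> Q (if Suc i < q then Suc i else Suc i + 2)"
      proof cases
        case 2
        have "Q i \<le> Q (Suc i)" "Q (Suc q) \<le> Q (Suc (Suc q))" using i r 2 by (auto intro!: mono)
        then show ?thesis using 2 eq by auto
      qed (use i r in \<open>auto intro!: mono\<close>)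
    qed (use r in simp)
    also have "\<dots> \<le> excess \<gamma> n Q" unfolding r by (rule excess_delete[OF alt mono eq]) (use r in simp)
    finally show ?thesis .
  next
    assume gap: "Q (Suc q) - Q q \<ge> 1"
    obtain r where r: "n = Suc q + Suc r" using q(1) by (auto dest!: less_imp_Suc_add)
    have "0 \<le> excess \<gamma> (Suc q) Q" 
      by (rule less.IH) (use r alt mono in auto)
    moreover have "0 \<le> excess (\<lambda>i. \<gamma> (Suc q + i)) (Suc r) (\<lambda>i. Q (Suc q + i))"
      by (rule less.IH[OF _ alternating_shift[OF alt]]) (use r mono in auto)
    moreover have "excess \<gamma> n Q \<ge> excess \<gamma> (Suc q) Q + excess (\<lambda>i. \<gamma> (Suc q + i)) (Suc r) (\<lambda>i. Q (Suc q + i))"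
      unfolding r by (rule excess_split[OF alt mono gap]) (use r in simp)
    ultimately show ?thesis by simp
  qed
  show ?case
  proof (cases "short_gaps n P")
    case False
    then obtain q where q: "Suc q < n" "P (Suc q) > P q + 1" 
      using less.prems(2) by (auto simp: short_gaps_def not_le)
    show ?thesis
    proof (rule degenerate)
      show "Suc q < n" by (rule q(1))
      show "P q = P (Suc q) \<or> 1 \<le> P (Suc q) - P q" using q(2) by simp
    qed (rule less.prems(2))
  next
    case sP: True
    \<comment> \<open>Under \<open>short_gaps\<close> any two positions differ by at most
      \<open>n\<close>, so \<open>C\<close> bounds the penalty sum of every minimiser, independently
      of \<open>\<eta>\<close>.\<close>
    define C where "C = (\<Sum>i<n. \<Sum>j<n. real n + 1 + (real n)\<^sup>2)"
    have "excess \<gamma> n P + \<eta> * C \<ge> 0" if \<eta>: "\<eta> > 0" for \<eta>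
    proof -
      obtain Q where Q: "short_gaps n Q" "\<And>R. short_gaps n R \<Longrightarrow> penalized \<eta> \<gamma> n Q \<le> penalized \<eta> \<gamma> n R"
        using penalized_attains_min by blast
      have Qmono: "Q i \<le> Q (Suc i)" if "Suc i < n" for i using Q(1) that by (simp add: short_gaps_def)
      have "excess \<gamma> n Q \<ge> 0"
      proof (cases "\<exists>q. Suc q < n \<and> (Q q = Q (Suc q) \<or> Q (Suc q) - Q q \<ge> 1)")
        case True
        then obtain q where "Suc q < n" "Q q = Q (Suc q) \<or> Q (Suc q) - Q q \<ge> 1" by blast
        then show ?thesis by (intro degenerate Qmono)
      next
        case False
        have "Q i < Q (Suc i) \<and> Q (Suc i) < Q i + 1" if "Suc i < n" for i
          using False that Qmono[OF that] by force
        then have "Q (p + 2) - Q p \<ge> 1" if "p + 2 < n" for p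
          using minimizer_separated[of n Q \<eta> \<gamma> p] Q(2) \<eta> that by blast
        then show ?thesis by (rule excess_separated[OF Q(1)])
      qed
      moreover have "(\<Sum>i<n. \<Sum>j<n. kink (Q i - Q j)) \<le> C"
        unfolding C_def
      proof (intro sum_mono)
        fix i j assume "i \<in> {..<n}" "j \<in> {..<n}"
        then have "\<bar>Q i - Q j\<bar> \<le> real n"
          using short_gaps_bounds[OF Q(1), of i] short_gaps_bounds[OF Q(1), of j] by auto
        moreover from this have "(Q i - Q j)\<^sup>2 \<le> (real n)\<^sup>2" by (simp add: abs_le_square_iff[symmetric])
        ultimately show "kink (Q i - Q j) \<le> real n + 1 + (real n)\<^sup>2" by (simp add: kink_def)
      qed
      then have "\<eta> * (\<Sum>i<n. \<Sum>j<n. kink (Q i - Q j)) \<le> \<eta> * C" using \<eta> by simp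
      moreover have "0 \<le> \<eta> * (\<Sum>i<n. \<Sum>j<n. kink (P i - P j))"
        using \<eta> by (intro mult_nonneg_nonneg sum_nonneg) (auto simp: kink_def)
      ultimately show ?thesis using Q(2)[OF sP] by (simp add: penalized_def)
    qed
    moreover have "C \<ge> 0" unfolding C_def by (intro sum_nonneg) auto
    ultimately show ?thesis
    proof -
      assume *: "\<And>\<eta>. \<eta> > 0 \<Longrightarrow> excess \<gamma> n P + \<eta> * C \<ge> 0" and "C \<ge> 0"
      show ?thesis
      proof (rule field_le_epsilon)
        fix e :: real assume "e > 0"
        have "e / (C + 1) * C \<le> e" using \<open>e > 0\<close> \<open>C \<ge> 0\<close> by (simp add: field_simps)
        then show "0 \<le> excess \<gamma> n P + e" using *[of "e / (C+1)"] \<open>e > 0\<close> \<open>C \<ge> 0\<close> by simp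
      qed
    qed
  qed
qed

section \<open>Discretisation\<close>

\<comment> \<open>The endpoints obtained by pushing the part of the set in each cell \<open>[a h, (a+1) h)\<close> to the left end of the cell.\<close>
definition cells :: "real \<Rightarrow> (nat \<Rightarrow> real) \<Rightarrow> nat \<Rightarrow> real" where
  "cells h \<nu> k = real (k div 2) * h + (if odd k then \<nu> (k div 2) else 0)"

lemma cells_even [simp]: "cells h \<nu> (2 * a) = real a * h"
  by (simp add: cells_def)

lemma cells_odd [simp]: "cells h \<nu> (Suc (2 * a)) = real a * h + \<nu> a"
  by (simp add: cells_def)

lemma sum_even_odd: "(\<Sum>k<2*n. f k) = (\<Sum>a<n. f (2*a) + f (Suc (2*a)) :: real)"
  by (induction n) simp_all

lemma cells_interaction:
  assumes h: "0 \<le> h" "real r * h \<ge> 1" and \<nu>: "0 \<le> \<nu> a" "\<nu> a \<le> h" "0 \<le> \<nu> b" and ab: "a < b"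
  shows "hat (real b * h - real a * h) - hat (real b * h + \<nu> b - real a * h)
       - hat (real b * h - (real a * h + \<nu> a)) + hat (real b * h + \<nu> b - (real a * h + \<nu> a))
     \<ge> - 2 * (\<nu> a * \<nu> b * of_bool (b \<le> a + r))"
proof -
  define u where "u = real b * h - real a * h - \<nu> a"
  have "real (Suc a) * h \<le> real b * h" using ab h by (intro mult_right_mono) auto
  then have u: "0 \<le> u" using \<nu> by (simp add: u_def algebra_simps)
  have *: "real b * h - real a * h = u + \<nu> a" "real b * h + \<nu> b - real a * h = u + \<nu> a + \<nu> b"
    "real b * h - (real a * h + \<nu> a) = u" "real b * h + \<nu> b - (real a * h + \<nu> a) = u + \<nu> b"
    by (simp_all add: u_def)
  show ?thesis
  proof (cases "b \<le> a + r")
    case True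
    then show ?thesis unfolding * using mixed_diff_hat[OF u \<nu>(1) \<nu>(3)] by simp
  next
    case False
    then have "real (a + r + 1) * h \<le> real b * h" using h by (intro mult_right_mono) auto
    then have "u \<ge> 1" using h \<nu> by (simp add: u_def algebra_simps)
    then show ?thesis unfolding * using \<nu> False by (simp add: hat_eq_0)
  qed
qed

text \<open>Grouping endpoints by cell, a diagonal block equals
  \<open>4 * \<nu> a - 2 * \<nu> a * \<nu> a\<close>. The bound is the discrete form of four times
  the measure of the set minus twice that of its close pairs.\<close>

lemma interaction_cells_ge:
  assumes h: "0 \<le> h" "h \<le> 1" "real r * h \<ge> 1" and \<nu>: "\<And>a. 0 \<le> \<nu> a" "\<And>a. \<nu> a \<le> h"
  shows "interaction (2 * K) (cells h \<nu>) \<ge>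
    4 * (\<Sum>a<K. \<nu> a) - 2 * (\<Sum>a<K. \<Sum>b<K. \<nu> a * \<nu> b * of_bool (b \<le> a + r \<and> a \<le> b + r))"
proof -
  define D where "D a b = hat (real a * h - real b * h) - hat (real a * h - (real b * h + \<nu> b))
       - hat (real a * h + \<nu> a - real b * h) + hat (real a * h + \<nu> a - (real b * h + \<nu> b))" for a b
  have sgn: "(-1::real)^(2*a + k) = (-1)^k" for a k by (simp add: power_add)
  have "interaction (2 * K) (cells h \<nu>) = (\<Sum>a<K. \<Sum>b<K. D a b)"
    unfolding interaction_nested sum_even_odd
    by (intro sum.cong refl) (simp add: D_def flip: sum_subtractf, simp add: algebra_simps)
  also have "\<dots> \<ge> (\<Sum>a<K. \<Sum>b<K. (if a = b then 4 * \<nu> a else 0) - 2 * (\<nu> a * \<nu> b * of_bool (b \<le> a + r \<and> a \<le> b + r)))"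
  proof (intro sum_mono)
    fix a b :: nat
    consider "a = b" | "a < b" | "b < a" by linarith
    then show "(if a = b then 4 * \<nu> a else 0) - 2 * (\<nu> a * \<nu> b * of_bool (b \<le> a + r \<and> a \<le> b + r)) \<le> D a b"
    proof cases
      case 1
      have "hat (\<nu> a) = (1 - \<nu> a)\<^sup>2" using h \<nu>[of a] by (simp add: hat_def)
      then show ?thesis using 1 by (simp add: D_def power2_eq_square algebra_simps)
    next
      case 2
      have "D a b = hat (real b * h - real a * h) - hat (real b * h + \<nu> b - real a * h)
       - hat (real b * h - (real a * h + \<nu> a)) + hat (real b * h + \<nu> b - (real a * h + \<nu> a))"
        unfolding D_def by (simp only: hat_minus_commute[of "real b * h"] hat_minus_commute[of "real b * h + \<nu> b"])
      then show ?thesis using cells_interaction[OF h(1,3) \<nu>(1)[of a] \<nu>(2)[of a] \<nu>(1)[of b] 2] 2 by simp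
    next
      case 3
      have "D a b = hat (real a * h - real b * h) - hat (real a * h + \<nu> a - real b * h)
       - hat (real a * h - (real b * h + \<nu> b)) + hat (real a * h + \<nu> a - (real b * h + \<nu> b))"
        unfolding D_def by simp
      then show ?thesis using cells_interaction[OF h(1,3) \<nu>(1)[of b] \<nu>(2)[of b] \<nu>(1)[of a] 3] 3 
        by (simp add: mult.commute)
    qed
  qed
  also have "(\<Sum>a<K. \<Sum>b<K. (if a = b then 4 * \<nu> a else 0) - 2 * (\<nu> a * \<nu> b * of_bool (b \<le> a + r \<and> a \<le> b + r)))
    = 4 * (\<Sum>a<K. \<nu> a) - 2 * (\<Sum>a<K. \<Sum>b<K. \<nu> a * \<nu> b * of_bool (b \<le> a + r \<and> a \<le> b + r))"
    unfolding sum_subtractf sum_distrib_left by simp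
  finally show ?thesis .
qed

lemma sum_near_diagonal_le:
  fixes \<nu> :: "nat \<Rightarrow> real"
  assumes "\<And>a. 0 \<le> \<nu> a"
  shows "(\<Sum>a<K. \<Sum>b<K. \<nu> a * \<nu> b * of_bool (b \<le> a + r \<and> a \<le> b + r))
     \<le> (\<Sum>a<K. \<nu> a * \<nu> a + 2 * (\<Sum>j=1..r. \<nu> a * \<nu> (a + j)))"
proof -
  define U where "U a b = \<nu> a * \<nu> b * of_bool (a < b \<and> b \<le> a + r)" for a b
  have "(\<Sum>a<K. \<Sum>b<K. \<nu> a * \<nu> b * of_bool (b \<le> a + r \<and> a \<le> b + r)) =
      (\<Sum>a<K. \<Sum>b<K. (if a = b then \<nu> a * \<nu> a else 0) + U a b + U b a)"
    by (intro sum.cong refl) (auto simp: U_def)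
  also have "\<dots> = (\<Sum>a<K. \<nu> a * \<nu> a) + (\<Sum>a<K. \<Sum>b<K. U a b) + (\<Sum>a<K. \<Sum>b<K. U b a)"
    by (simp add: sum.distrib)
  also have "(\<Sum>a<K. \<Sum>b<K. U b a) = (\<Sum>a<K. \<Sum>b<K. U a b)" by (rule sum.swap)
  also have "(\<Sum>a<K. \<Sum>b<K. U a b) \<le> (\<Sum>a<K. \<Sum>j=1..r. \<nu> a * \<nu> (a + j))"
  proof (rule sum_mono)
    fix a
    have "(\<Sum>b<K. U a b) = (\<Sum>b\<in>{..<K} \<inter> {a+1..a+r}. \<nu> a * \<nu> b)"
      by (rule sum.mono_neutral_cong_right) (auto simp: U_def)
    \<comment> \<open>Indices from \<open>K\<close> on are added, which only enlarges a sum of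
      nonnegative products.\<close>
    also have "\<dots> \<le> (\<Sum>b\<in>{a+1..a+r}. \<nu> a * \<nu> b)" using assms by (intro sum_mono2) auto
    also have "\<dots> = (\<Sum>j=1..r. \<nu> a * \<nu> (a + j))"
      by (rule sum.reindex_bij_witness[of _ "\<lambda>j. a + j" "\<lambda>b. b - a"]) auto
    finally show "(\<Sum>b<K. U a b) \<le> (\<Sum>j=1..r. \<nu> a * \<nu> (a + j))" .
  qed
  finally show ?thesis by (simp add: sum.distrib sum_distrib_left)
qed

lemma sum_periodic:
  fixes f :: "nat \<Rightarrow> real"
  assumes "\<And>a. f (a + N) = f a"
  shows "(\<Sum>a<q*N. f a) = real q * (\<Sum>a<N. f a)"
proof (induction q)
  case (Suc q)
  have per: "f (q * N + a) = f a" for a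
    by (induction q) (use assms in \<open>simp_all add: add_ac\<close>, metis add.assoc add.commute assms)
  have "(\<Sum>a<Suc q*N. f a) = (\<Sum>a<q*N+N. f a)" by (simp add: add.commute)
  also have "\<dots> = real q * (\<Sum>a<N. f a) + (\<Sum>a<N. f a)"
    unfolding sum_lessThan_add Suc.IH per ..
  finally show ?case by (simp add: algebra_simps)
qed simp

text \<open>\<open>excess_nonneg\<close> with weight \<open>c\<close> on the filled and
  \<open>s\<close> on the empty part of each cell.\<close>

lemma interaction_cells_le:
  assumes h: "0 \<le> h" and \<nu>: "\<And>a. 0 \<le> \<nu> a" "\<And>a. \<nu> a \<le> h"
    and cs: "0 \<le> c" "0 \<le> s" "c\<^sup>2 + s\<^sup>2 = 1"
  shows "interaction (2 * K) (cells h \<nu>) \<le> 4 * (\<Sum>a<K. (1 - c) * \<nu> a + (1 - s) * (h - \<nu> a)) + 2"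
proof (cases "K = 0")
  case True
  then show ?thesis by (simp add: interaction_def)
next
  case False
  define \<gamma> where "\<gamma> k = (if even k then c else s)" for k :: nat
  have alt: "alternating \<gamma>" using cs by (auto simp: alternating_def \<gamma>_def)
  have mono: "cells h \<nu> k \<le> cells h \<nu> (Suc k)" for k
  proof (cases "even k")
    case True
    then show ?thesis using \<nu> by (auto elim!: evenE)
  next
    case odd: False
    then obtain a where "k = Suc (2 * a)" by (auto elim!: oddE)
    moreover have "cells h \<nu> (Suc (Suc (2 * a))) = real (Suc a) * h" using cells_even[of h \<nu> "Suc a"] by simp
    moreover have "real a * h + \<nu> a \<le> real (Suc a) * h" using \<nu>(2)[of a] by (simp add: algebra_simps)
    ultimately show ?thesis by (simp only: cells_odd)
  qed
  then have "0 \<le> excess \<gamma> (2 * K) (cells h \<nu>)" by (intro excess_nonneg alt)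
  then have le: "interaction (2 * K) (cells h \<nu>) \<le> 2 * runs \<gamma> (2 * K) (cells h \<nu>) + 2 * real K"
    by (simp add: excess_def field_simps)
  define G where "G k = 2 * (1 - \<gamma> k) * (cells h \<nu> (Suc k) - cells h \<nu> k) - 1 + (\<gamma> k)\<^sup>2" for k
  \<comment> \<open>The empty part of the last cell is not a run of the sequence. Adding it
    completes the sum over cells at a cost of at most 1, which becomes the additive 2 in the
    bound.\<close>
  have last: "G (2*K-1) \<ge> -1"
  proof -
    have "0 \<le> 2 * (1 - \<gamma> (2*K-1)) * (cells h \<nu> (Suc (2*K-1)) - cells h \<nu> (2*K-1))"
      using mono[of "2*K-1"] alternating_le_1[OF alt, of "2*K-1"] by (intro mult_nonneg_nonneg) auto
    moreover have "0 \<le> (\<gamma> (2*K-1))\<^sup>2" by simp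
    ultimately show ?thesis unfolding G_def by linarith
  qed
  have "runs \<gamma> (2 * K) (cells h \<nu>) = (\<Sum>k<2*K-1. G k)" by (simp add: runs_def G_def)
  also have "\<dots> = (\<Sum>k<2*K. G k) - G (2*K-1)"
  proof -
    have "2 * K = Suc (2*K-1)" using False by simp
    then show ?thesis by (metis add_diff_cancel_right' sum.lessThan_Suc)
  qed
  also have "(\<Sum>k<2*K. G k) = (\<Sum>a<K. 2 * ((1 - c) * \<nu> a + (1 - s) * (h - \<nu> a)) - 1)"
    unfolding sum_even_odd
  proof (intro sum.cong refl)
    fix a
    have "cells h \<nu> (Suc (Suc (2 * a))) = real (Suc a) * h" using cells_even[of h \<nu> "Suc a"] by simp
    then have "G (2 * a) + G (Suc (2 * a)) =
        2 * (1 - c) * \<nu> a + 2 * (1 - s) * (real (Suc a) * h - (real a * h + \<nu> a)) - 2 + (c\<^sup>2 + s\<^sup>2)"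
      by (simp add: G_def \<gamma>_def)
    then show "G (2 * a) + G (Suc (2 * a)) = 2 * ((1 - c) * \<nu> a + (1 - s) * (h - \<nu> a)) - 1"
      unfolding cs(3) by (simp add: algebra_simps)
  qed
  finally have "runs \<gamma> (2 * K) (cells h \<nu>) \<le> 2 * (\<Sum>a<K. (1 - c) * \<nu> a + (1 - s) * (h - \<nu> a)) - real K + 1"
    using last by (simp add: sum_subtractf sum_distrib_left)
  with le show ?thesis by simp
qed

text \<open>
  The circle is unrolled \<open>q\<close> times; the two ends of the resulting segment cost an error \<open>1 / q\<close>.
\<close>

lemma cell_correlation_ge:
  fixes \<mu> :: "nat \<Rightarrow> real" and \<xi> L :: real
  defines "\<rho> \<equiv> sqrt (2 * \<xi>\<^sup>2 - 2 * \<xi> + 1)"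
  assumes N: "0 < N" and h: "h = L / real N" "0 \<le> h" "h \<le> 1" and m: "1 \<le> (real m + 2) * h"
    and \<mu>: "\<And>a. 0 \<le> \<mu> a" "\<And>a. \<mu> a \<le> h" "(\<Sum>a<N. \<mu> a) = \<xi> * L" and \<xi>: "0 \<le> \<xi>" "\<xi> \<le> 1" and q: "0 < q"
  shows "(\<Sum>a<N. \<Sum>j=1..m. \<mu> a * \<mu> ((a + j) mod N)) \<ge> (\<xi> + \<rho> - 1) * L - 3 * h * (\<xi> * L) - 1 / real q"
proof -
  define T where "T r = (\<Sum>a<N. \<Sum>j=1..r. \<mu> a * \<mu> ((a + j) mod N))" for r
  define \<nu> where "\<nu> a = \<mu> (a mod N)" for a
  have \<nu>: "0 \<le> \<nu> a" "\<nu> a \<le> h" for a using \<mu> by (auto simp: \<nu>_def)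
  have \<nu>N: "\<nu> a = \<mu> a" if "a < N" for a using that by (simp add: \<nu>_def)
  have per: "\<nu> (a + N) = \<nu> a" for a by (simp add: \<nu>_def)
  have per': "\<nu> (a + N + j) = \<nu> (a + j)" for a j using per[of "a + j"] by (simp add: add_ac)
  have \<rho>2: "\<rho>\<^sup>2 = \<xi>\<^sup>2 + (1 - \<xi>)\<^sup>2" and \<rho>: "\<rho> > 0"
  proof -
    have "2 * \<xi>\<^sup>2 - 2 * \<xi> + 1 = \<xi>\<^sup>2 + (1 - \<xi>)\<^sup>2" by (simp add: power2_eq_square algebra_simps)
    moreover have "\<xi>\<^sup>2 + (1 - \<xi>)\<^sup>2 > 0"
      by (cases "\<xi> = 0") (auto simp: add_pos_nonneg)
    ultimately show "\<rho>\<^sup>2 = \<xi>\<^sup>2 + (1 - \<xi>)\<^sup>2" "\<rho> > 0" by (simp_all add: \<rho>_def)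
  qed
  \<comment> \<open>The unit vector in the direction of \<open>(\<xi>, 1 - \<xi>)\<close>, which
    makes the inner product with it equal to \<open>\<rho>\<close>.\<close>
  define c s where "c = \<xi> / \<rho>" and "s = (1 - \<xi>) / \<rho>"
  have cs: "0 \<le> c" "0 \<le> s" using \<xi> \<rho> by (auto simp: c_def s_def)
  have "c\<^sup>2 + s\<^sup>2 = (\<xi>\<^sup>2 + (1 - \<xi>)\<^sup>2) / \<rho>\<^sup>2" by (simp add: c_def s_def power_divide add_divide_distrib)
  then have cs1: "c\<^sup>2 + s\<^sup>2 = 1" using \<rho> by (simp add: \<rho>2[symmetric])
  have "c * \<xi> + s * (1 - \<xi>) = \<rho>\<^sup>2 / \<rho>" unfolding \<rho>2
    by (simp add: c_def s_def power2_eq_square add_divide_distrib)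
  then have cs\<rho>: "c * \<xi> + s * (1 - \<xi>) = \<rho>" using \<rho> by (simp add: power2_eq_square)
  have sum\<nu>: "(\<Sum>a<q*N. \<nu> a) = real q * (\<xi> * L)"
    using sum_periodic[of \<nu> N q, OF per] \<nu>N \<mu>(3) by simp
  have hN: "real N * h = L" using N h(1) by simp
  have "interaction (2 * (q * N)) (cells h \<nu>) \<le> 4 * (\<Sum>a<q*N. (1 - c) * \<nu> a + (1 - s) * (h - \<nu> a)) + 2"
    by (rule interaction_cells_le[OF h(2) \<nu> cs cs1])
  also have "(\<Sum>a<q*N. (1 - c) * \<nu> a + (1 - s) * (h - \<nu> a)) =
      (1 - c) * (\<Sum>a<q*N. \<nu> a) + (1 - s) * (real q * (real N * h) - (\<Sum>a<q*N. \<nu> a))"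
    by (simp add: sum.distrib sum_subtractf sum_distrib_left right_diff_distrib)
  also have "\<dots> = real q * L * (1 - (c * \<xi> + s * (1 - \<xi>)))"
    unfolding sum\<nu> hN by (simp add: algebra_simps)
  finally have up: "interaction (2 * (q * N)) (cells h \<nu>) \<le> 4 * (real q * L * (1 - \<rho>)) + 2" unfolding cs\<rho> .
  \<comment> \<open>Offsets up to \<open>m + 2\<close> are needed to cover distance 1, but only
    those up to \<open>m\<close> are kept. The diagonal and the last two offsets cost a multiple of
    \<open>h * (\<xi> * L)\<close>.\<close>
  have "(\<Sum>a<q*N. \<nu> a * \<nu> a + 2 * (\<Sum>j=1..m+2. \<nu> a * \<nu> (a + j))) =
      real q * (\<Sum>a<N. \<nu> a * \<nu> a + 2 * (\<Sum>j=1..m+2. \<nu> a * \<nu> (a + j)))"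
    by (rule sum_periodic) (simp add: per per')
  also have "(\<Sum>a<N. \<nu> a * \<nu> a + 2 * (\<Sum>j=1..m+2. \<nu> a * \<nu> (a + j))) = (\<Sum>a<N. \<mu> a * \<mu> a) + 2 * T (m + 2)"
    by (simp add: \<nu>N T_def sum.distrib sum_distrib_left) (simp add: \<nu>_def)
  also have "(\<Sum>a<N. \<mu> a * \<mu> a) \<le> h * (\<xi> * L)"
  proof -
    have "(\<Sum>a<N. \<mu> a * \<mu> a) \<le> (\<Sum>a<N. h * \<mu> a)" using \<mu> by (intro sum_mono mult_right_mono) auto
    then show ?thesis by (simp add: \<mu>(3) flip: sum_distrib_left)
  qed
  also have "T (m + 2) \<le> T m + 2 * (h * (\<xi> * L))"
  proof -
    have split: "T (m + 2) = T m + (\<Sum>a<N. \<mu> a * \<mu> ((a + (m+1)) mod N)) + (\<Sum>a<N. \<mu> a * \<mu> ((a + (m+2)) mod N))"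
      by (simp add: T_def sum.distrib)
    have bound: "(\<Sum>a<N. \<mu> a * \<mu> ((a + j) mod N)) \<le> h * (\<xi> * L)" for j
    proof -
      have "(\<Sum>a<N. \<mu> a * \<mu> ((a + j) mod N)) \<le> (\<Sum>a<N. \<mu> a * h)" using \<mu> by (intro sum_mono mult_left_mono) auto
      also have "\<dots> = (\<Sum>a<N. \<mu> a) * h" by (simp only: sum_distrib_right)
      finally show ?thesis by (simp add: \<mu>(3) mult.commute)
    qed
    show ?thesis using split bound[of "m + 1"] bound[of "m + 2"] by linarith
  qed
  finally have "(\<Sum>a<q*N. \<nu> a * \<nu> a + 2 * (\<Sum>j=1..m+2. \<nu> a * \<nu> (a + j))) \<le>
      real q * (h * (\<xi> * L) + 2 * (T m + 2 * (h * (\<xi> * L))))"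
    by (simp add: mult_left_mono)
  also have "\<dots> = real q * (2 * T m + 5 * (h * (\<xi> * L)))" by (simp add: algebra_simps)
  finally have near: "(\<Sum>a<q*N. \<nu> a * \<nu> a + 2 * (\<Sum>j=1..m+2. \<nu> a * \<nu> (a + j))) \<le>
      real q * (2 * T m + 5 * (h * (\<xi> * L)))" .
  have "4 * (real q * (\<xi> * L)) - 2 * (real q * (2 * T m + 5 * (h * (\<xi> * L)))) \<le> interaction (2 * (q * N)) (cells h \<nu>)"
  proof -
    have "1 \<le> real (m + 2) * h" using m by (simp add: add.commute)
    from interaction_cells_ge[where \<nu> = \<nu>, OF h(2,3) this \<nu>, where K = "q * N"]
    have "interaction (2 * (q * N)) (cells h \<nu>) \<ge> 4 * (real q * (\<xi> * L)) -
        2 * (\<Sum>a<q*N. \<Sum>b<q*N. \<nu> a * \<nu> b * of_bool (b \<le> a + (m + 2) \<and> a \<le> b + (m + 2)))"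
      unfolding sum\<nu> .
    moreover have "(\<Sum>a<q*N. \<Sum>b<q*N. \<nu> a * \<nu> b * of_bool (b \<le> a + (m + 2) \<and> a \<le> b + (m + 2))) \<le>
        real q * (2 * T m + 5 * (h * (\<xi> * L)))"
      using sum_near_diagonal_le[OF \<nu>(1)] near by (rule order_trans)
    ultimately show ?thesis by linarith
  qed
  with up have "real q * (4 * (\<xi> * L) - 4 * T m - 10 * (h * (\<xi> * L)) - 4 * (L * (1 - \<rho>))) \<le> 2"
    by (simp add: algebra_simps)
  then have "4 * (\<xi> * L) - 4 * T m - 10 * (h * (\<xi> * L)) - 4 * (L * (1 - \<rho>)) \<le> 2 / real q"
    using q by (simp add: field_simps)
  moreover have "0 \<le> h * (\<xi> * L)" using h(2) \<xi>(1) unfolding hN[symmetric] by simp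
  moreover have "0 \<le> 1 / real q" "2 / real q = 2 * (1 / real q)" by simp_all
  \<comment> \<open>The error coefficients 10/4 and 1/2 are rounded up to 3 and 1.\<close>
  ultimately have "T m \<ge> \<xi> * L - L * (1 - \<rho>) - 3 * (h * (\<xi> * L)) - 1 / real q" by linarith
  then show ?thesis by (simp add: T_def algebra_simps)
qed

section \<open>Reduction to cells\<close>

definition close_pairs :: "real \<Rightarrow> real set \<Rightarrow> (real \<times> real) set" where
  "close_pairs L A = {(x, t). x \<in> A \<and> t \<in> {0..1} \<and> circle_add L x t \<in> A}"

lemma Phi_close_pairs: "Phi L A = measure lebesgue (close_pairs L A)"
  by (simp add: Phi_def close_pairs_def)

section \<open>Measurability of the set of close pairs\<close>

text \<open>Since \<open>t \<le> 1 \<le> L\<close>, reduction modulo \<open>L\<close> subtracts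
  \<open>L\<close> at most once.\<close>

lemma circle_add_mem_iff:
  assumes "L \<ge> 1" "A \<subseteq> {0..<L}" "x \<in> {0..<L}" "t \<in> {0..1}"
  shows "circle_add L x t \<in> A \<longleftrightarrow> x + t \<in> A \<or> x + t - L \<in> A"
proof (cases "x + t < L")
  case True
  have "(x + t) rmod L = x + t" by (rule rmod_unique[where n = 0]) (use assms True in auto)
  moreover have "x + t - L \<notin> A" using assms True by auto
  ultimately show ?thesis by (simp add: circle_add_def)
next
  case False
  have "(x + t) rmod L = x + t - L" by (rule rmod_unique[where n = 1]) (use assms False in auto)
  moreover have "x + t \<notin> A" using assms False by auto
  ultimately show ?thesis by (simp add: circle_add_def)
qed

lemma emeasure_lborel_translate:
  assumes "B \<in> sets borel"
  shows "emeasure lborel {t. x + t \<in> B} = emeasure lborel (B :: real set)"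
proof -
  have "emeasure lborel B = emeasure (distr lborel borel ((+) x)) B" by (simp add: lborel_distr_plus)
  also have "\<dots> = emeasure lborel {t. x + t \<in> B}"
    using assms by (subst emeasure_distr) (auto simp: vimage_def)
  finally show ?thesis ..
qed

lemma null_sets_fst:
  assumes "N \<in> null_sets lborel"
  shows "{(x, t :: real). (x :: real) \<in> N} \<in> null_sets lborel"
proof -
  have N: "N \<in> sets borel" using assms by auto
  have eq: "{(x, t :: real). (x :: real) \<in> N} = N \<times> UNIV" by auto
  have "emeasure (lborel \<Otimes>\<^sub>M lborel) (N \<times> (UNIV :: real set)) = emeasure lborel N * emeasure lborel (UNIV :: real set)"
    using N by (intro lborel.emeasure_pair_measure_Times) auto
  moreover have "N \<times> (UNIV :: real set) \<in> sets borel" using N by (intro borel_Times) auto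
  ultimately show ?thesis using assms unfolding eq by (auto simp: lborel_prod null_sets_def)
qed

text \<open>Every vertical slice is a translate of \<open>N\<close>, hence null, and the slices are
  integrated.\<close>

lemma null_sets_add:
  assumes "N \<in> null_sets lborel"
  shows "{(x :: real, t :: real). x + t + c \<in> N} \<in> null_sets lborel"
proof -
  have N: "N \<in> sets borel" using assms by auto
  have meas: "{(x :: real, t :: real). x + t + c \<in> N} \<in> sets borel"
  proof -
    have "(\<lambda>p::real \<times> real. fst p + snd p + c) \<in> borel_measurable borel"
      by (intro borel_measurable_continuous_onI continuous_intros)
    from measurable_sets[OF this N] show ?thesis by (simp add: vimage_def case_prod_unfold)
  qed
  then have "emeasure (lborel \<Otimes>\<^sub>M lborel) {(x :: real, t :: real). x + t + c \<in> N} =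
      (\<integral>\<^sup>+x. emeasure lborel (Pair x -` {(x :: real, t :: real). x + t + c \<in> N}) \<partial>lborel)"
    by (intro lborel.emeasure_pair_measure_alt) (simp only: lborel_prod sets_lborel)
  also have "\<dots> = (\<integral>\<^sup>+(x::real). 0 \<partial>lborel)"
  proof (intro nn_integral_cong)
    fix x :: real
    have "Pair x -` {(x :: real, t :: real). x + t + c \<in> N} = {t. (x + c) + t \<in> N}" by (auto simp: add_ac)
    then show "emeasure lborel (Pair x -` {(x :: real, t :: real). x + t + c \<in> N}) = 0"
      using emeasure_lborel_translate[OF N, of "x + c"] assms by auto
  qed
  finally show ?thesis using meas by (auto simp: lborel_prod null_sets_def)
qed

lemma close_pairs_borel:
  assumes "L \<ge> 1" "S \<in> sets borel" "S \<subseteq> {0..<L}"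
  shows "close_pairs L S \<in> sets borel"
proof -
  have "close_pairs L S = {p. fst p \<in> S \<and> snd p \<in> {0..1} \<and> (fst p + snd p \<in> S \<or> fst p + snd p - L \<in> S)}"
    using circle_add_mem_iff[OF assms(1,3)] assms(3) by (fastforce simp: close_pairs_def)
  moreover have "{p. f p \<in> B} \<in> sets borel"
    if "continuous_on UNIV f" "B \<in> sets borel" for f :: "real \<times> real \<Rightarrow> real" and B
    using measurable_sets_borel[OF borel_measurable_continuous_onI[OF that(1)] that(2)] by (simp add: vimage_def)
  from this[of fst S] this[of snd "{0..1}"] this[of "\<lambda>p. fst p + snd p" S] this[of "\<lambda>p. fst p + snd p - L" S]
  have "{p. fst p \<in> S} \<inter> {p. snd p \<in> {0..1}} \<inter> ({p. fst p + snd p \<in> S} \<union> {p. fst p + snd p - L \<in> S}) \<in> sets borel"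
    using assms(2) by (intro sets.Int sets.Un) (simp_all add: continuous_on_fst continuous_on_snd continuous_on_add continuous_on_diff continuous_on_id)
  moreover have "{p. fst p \<in> S} \<inter> {p. snd p \<in> {0..1}} \<inter> ({p. fst p + snd p \<in> S} \<union> {p. fst p + snd p - L \<in> S}) =
      {p. fst p \<in> S \<and> snd p \<in> {0..1} \<and> (fst p + snd p \<in> S \<or> fst p + snd p - L \<in> S)}" by blast
  ultimately show ?thesis by metis
qed

text \<open>On passing to the Borel part of \<open>A\<close>, the lost pairs have \<open>x\<close>,
  \<open>x + t\<close> or \<open>x + t - L\<close> in a Borel null set, so completeness of the
  measure applies.\<close>

lemma close_pairs_fmeasurable:
  assumes "L \<ge> 1" "A \<in> sets lebesgue" "A \<subseteq> {0..<L}"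
  shows "close_pairs L A \<in> fmeasurable lebesgue"
proof -
  define S where "S = main_part lborel A"
  have A: "A = S \<union> null_part lborel A" using assms(2) by (simp add: S_def)
  have S: "S \<in> sets borel" using assms(2) main_part_sets[of A lborel] by (simp add: S_def)
  have SA: "S \<subseteq> A" using A by blast
  obtain N where N: "N \<in> null_sets lborel" "null_part lborel A \<subseteq> N" using null_part[OF assms(2)] by blast
  define Y where "Y = {(x, t :: real). (x :: real) \<in> N} \<union> {(x :: real, t :: real). x + t + 0 \<in> N} \<union>
    {(x :: real, t :: real). x + t + - L \<in> N}"
  have Y: "Y \<in> null_sets lborel" unfolding Y_def by (intro null_sets.Un null_sets_fst null_sets_add N)
  have "close_pairs L A - close_pairs L S \<subseteq> Y"
  proof
    fix p assume "p \<in> close_pairs L A - close_pairs L S"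
    then obtain x t where p: "p = (x, t)" "x \<in> A" "t \<in> {0..1}" "circle_add L x t \<in> A"
      "\<not> (x \<in> S \<and> circle_add L x t \<in> S)" by (auto simp: close_pairs_def)
    have x: "x \<in> {0..<L}" using p assms by auto
    have SL: "S \<subseteq> {0..<L}" using SA assms(3) by blast
    have AN: "a \<in> S \<or> a \<in> N" if "a \<in> A" for a using A N(2) that by blast
    show "p \<in> Y"
    proof (cases "x \<in> S")
      case True
      with p have "circle_add L x t \<notin> S" by simp
      then have "x + t \<notin> S" "x + t - L \<notin> S" using circle_add_mem_iff[OF assms(1) SL x p(3)] by auto
      moreover have "x + t \<in> A \<or> x + t - L \<in> A" using circle_add_mem_iff[OF assms(1,3) x p(3)] p by auto
      ultimately have "x + t \<in> N \<or> x + t - L \<in> N" using AN by blast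
      then show ?thesis using p by (auto simp: Y_def)
    next
      case False
      then show ?thesis using AN[OF p(2)] p by (auto simp: Y_def)
    qed
  qed
  then have "close_pairs L A - close_pairs L S \<in> null_sets lebesgue"
    using Y by (meson null_sets_completionI null_sets_completion_subset)
  then have "close_pairs L A - close_pairs L S \<in> sets lebesgue" by blast
  moreover have "close_pairs L S \<in> sets lebesgue"
    using close_pairs_borel[OF assms(1) S] SA assms(3) by auto
  moreover have "close_pairs L S \<subseteq> close_pairs L A" using SA by (auto simp: close_pairs_def)
  ultimately have "close_pairs L A \<in> sets lebesgue" 
    by (metis Diff_partition sets.Un)
  moreover have "bounded (close_pairs L A)"
    by (rule bounded_subset[of "{0..L} \<times> {0..1}"]) (use assms in \<open>auto simp: close_pairs_def intro: bounded_Times\<close>)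
  ultimately show ?thesis by (simp add: bounded_set_imp_lmeasurable)
qed

section \<open>Passage from the circle to cell masses\<close>

text \<open>If \<open>x\<close> lies in cell \<open>a\<close> and \<open>x + t\<close> in cell
  \<open>a + j\<close> with \<open>1 \<le> j \<le> m\<close>, then \<open>t\<close> automatically
  lies between 0 and \<open>(m + 1) * h \<le> 1\<close>. So the slice at \<open>x\<close> has at
  least the total mass of these cells, and integrating over \<open>x\<close> gives the sum.\<close>

lemma Phi_ge_sections:
  assumes L: "L \<ge> 1" and A: "A \<in> sets lebesgue" "A \<subseteq> {0..<L}" and S: "S \<in> sets borel" "S \<subseteq> A"
    and h: "0 \<le> h" "L = real N * h" "(real m + 1) * h \<le> 1" 
  shows "Phi L A \<ge> (\<Sum>a<N. \<Sum>j=1..m. measure lborel (S \<inter> {real a * h..<real (Suc a) * h}) *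
      measure lborel (S \<inter> {real ((a + j) mod N) * h..<real (Suc ((a + j) mod N)) * h}))"
proof -
  define I where "I a = {real a * h..<real (Suc a) * h}" for a
  define \<mu> where "\<mu> a = measure lborel (S \<inter> I a)" for a
  have hpos: "h > 0" using h(1,2) L by (cases "h = 0") auto
  have SL: "S \<subseteq> {0..<L}" using A S by auto
  have fin: "emeasure lborel (B \<inter> I a) < \<infinity>" for B a
  proof -
    have "emeasure lborel (B \<inter> I a) \<le> emeasure lborel (I a)" by (intro emeasure_mono) (auto simp: I_def)
    also have "\<dots> < \<infinity>" unfolding I_def by (intro emeasure_bounded_finite) simp
    finally show ?thesis .
  qed
  have em: "emeasure lborel (S \<inter> I a) = ennreal (\<mu> a)" for a
    using fin[of S a] by (simp add: \<mu>_def emeasure_eq_ennreal_measure)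
  have disj: "I a \<inter> I b = {}" if "a \<noteq> b" for a b
  proof -
    have "I a \<inter> I b = {}" if "a < b" for a b
    proof -
      have "real (Suc a) * h \<le> real b * h" using that h(1) by (intro mult_right_mono) auto
      then show ?thesis by (auto simp: I_def)
    qed
    then show ?thesis using that by (metis Int_commute linorder_neqE_nat)
  qed
  \<comment> \<open>Two periods of \<open>S\<close>, so that cells past \<open>N\<close> are reached
    without reduction modulo \<open>L\<close>.\<close>
  define S' where "S' = S \<union> {y. y - L \<in> S}"
  have shift: "{y. y - L \<in> B} \<in> sets borel" if "B \<in> sets borel" for B
    using measurable_sets_borel[of "\<lambda>y. y - L" borel B] that by (simp add: vimage_def)
  have S'b: "S' \<in> sets borel" unfolding S'_def by (intro sets.Un S shift)
  have em': "emeasure lborel (S' \<inter> I b) \<ge> ennreal (\<mu> (b mod N))" if "b < 2 * N" for b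
  proof (cases "b < N")
    case True
    have "emeasure lborel (S \<inter> I b) \<le> emeasure lborel (S' \<inter> I b)"
      using S'b by (intro emeasure_mono) (auto simp: S'_def I_def)
    then show ?thesis using em True by simp
  next
    case False
    define a where "a = b - N"
    have ab: "b = a + N" "b mod N = a" using False that by (auto simp: a_def mod_if)
    have "ennreal (\<mu> a) = emeasure lborel (S \<inter> I a)" by (simp add: em)
    also have "\<dots> = emeasure lborel {y. - L + y \<in> S \<inter> I a}"
      using S by (intro emeasure_lborel_translate[symmetric]) (auto simp: I_def)
    also have "\<dots> \<le> emeasure lborel (S' \<inter> I b)"
      using S'b by (intro emeasure_mono) (auto simp: S'_def I_def ab h(2) algebra_simps)
    finally show ?thesis unfolding ab(2) .
  qed
  \<comment> \<open>This keeps \<open>a + j\<close> below \<open>2 * N\<close>, the range of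
    \<open>em'\<close>.\<close>
  have mN: "m < N"
  proof -
    have "(real m + 1) * h \<le> real N * h" using h L by simp
    then show ?thesis using hpos by (simp add: mult_le_cancel_right)
  qed
  define w where "w a = (\<Sum>j=1..m. \<mu> ((a + j) mod N))" for a
  have w0: "0 \<le> w a" for a unfolding w_def \<mu>_def by (intro sum_nonneg) auto
  have slice: "ennreal (w a) \<le> emeasure lborel (Pair x -` close_pairs L S)" if a: "a < N" and x: "x \<in> S \<inter> I a" for a x
  proof -
    have "ennreal (w a) = (\<Sum>j=1..m. ennreal (\<mu> ((a + j) mod N)))"
      by (simp add: w_def \<mu>_def sum_ennreal)
    also have "\<dots> \<le> (\<Sum>j=1..m. emeasure lborel (S' \<inter> I (a + j)))"
      using a mN by (intro sum_mono em') auto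
    also have "\<dots> = emeasure lborel (\<Union>j\<in>{1..m}. S' \<inter> I (a + j))"
    proof (rule sum_emeasure)
      show "(\<lambda>j. S' \<inter> I (a + j)) ` {1..m} \<subseteq> sets lborel" using S'b by (auto simp: I_def)
      show "disjoint_family_on (\<lambda>j. S' \<inter> I (a + j)) {1..m}"
        unfolding disjoint_family_on_def
      proof (intro ballI impI)
        fix i j :: nat assume "i \<noteq> j"
        then have "I (a + i) \<inter> I (a + j) = {}" by (intro disj) simp
        then show "S' \<inter> I (a + i) \<inter> (S' \<inter> I (a + j)) = {}" by blast
      qed
    qed simp
    also have "\<dots> = emeasure lborel {t. x + t \<in> (\<Union>j\<in>{1..m}. S' \<inter> I (a + j))}"
      using S'b by (intro emeasure_lborel_translate[symmetric] sets.finite_UN) (auto simp: I_def)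
    also have "\<dots> \<le> emeasure lborel (Pair x -` close_pairs L S)"
    proof (rule emeasure_mono)
      have "Pair x \<in> borel \<rightarrow>\<^sub>M (borel :: (real \<times> real) measure)"
        by (intro borel_measurable_continuous_onI continuous_intros)
      from measurable_sets[OF this close_pairs_borel[OF L S(1) SL]]
      show "Pair x -` close_pairs L S \<in> sets lborel" by simp
      show "{t. x + t \<in> (\<Union>j\<in>{1..m}. S' \<inter> I (a + j))} \<subseteq> Pair x -` close_pairs L S"
      proof (clarsimp simp: close_pairs_def)
        fix t j assume j: "Suc 0 \<le> j" "j \<le> m" "x + t \<in> S'" "x + t \<in> I (a + j)"
        have xI: "real a * h \<le> x" "x < real (Suc a) * h" using x by (auto simp: I_def)
        have "real (Suc a) * h \<le> real (a + j) * h" using j h(1) by (intro mult_right_mono) auto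
        then have t0: "0 \<le> t" using j xI by (simp add: I_def)
        have "real (Suc (a + j)) * h \<le> (real a + (real m + 1)) * h" using j h(1) by (intro mult_right_mono) auto
        also have "\<dots> = real a * h + (real m + 1) * h" by (simp add: algebra_simps)
        finally have t1: "t \<le> 1" using j xI h(3) by (simp add: I_def)
        have "circle_add L x t \<in> S"
          using circle_add_mem_iff[OF L SL, of x t] x SL t0 t1 j by (auto simp: S'_def)
        then show "x \<in> S \<and> 0 \<le> t \<and> t \<le> 1 \<and> circle_add L x t \<in> S" using x t0 t1 by simp
      qed
    qed
    finally show ?thesis .
  qed
  have "ennreal (\<Sum>a<N. \<mu> a * w a) = (\<Sum>a<N. ennreal (w a) * emeasure lborel (S \<inter> I a))"
    using w0 by (simp add: em \<mu>_def ennreal_mult[symmetric] mult.commute flip: sum_ennreal)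
  also have "\<dots> = (\<Sum>a<N. \<integral>\<^sup>+x. ennreal (w a) * indicator (S \<inter> I a) x \<partial>lborel)"
    using S by (intro sum.cong refl nn_integral_cmult_indicator[symmetric]) (auto simp: I_def)
  also have "\<dots> = (\<integral>\<^sup>+x. (\<Sum>a<N. ennreal (w a) * indicator (S \<inter> I a) x) \<partial>lborel)"
    using S by (intro nn_integral_sum[symmetric]) (auto simp: I_def)
  also have "\<dots> \<le> (\<integral>\<^sup>+x. emeasure lborel (Pair x -` close_pairs L S) \<partial>lborel)"
  proof (rule nn_integral_mono)
    fix x
    show "(\<Sum>a<N. ennreal (w a) * indicator (S \<inter> I a) x) \<le> emeasure lborel (Pair x -` close_pairs L S)"
    proof (cases "\<exists>a<N. x \<in> S \<inter> I a")
      case True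
      then obtain a where a: "a < N" "x \<in> S \<inter> I a" by blast
      have "(\<Sum>b<N. ennreal (w b) * indicator (S \<inter> I b) x) = (\<Sum>b<N. if b = a then ennreal (w a) else 0)"
        using a disj by (intro sum.cong refl) (auto simp: indicator_def)
      then show ?thesis using slice[OF a] a by simp
    next
      case False
      then have "(\<Sum>a<N. ennreal (w a) * indicator (S \<inter> I a) x) = 0" by (intro sum.neutral) auto
      then show ?thesis by simp
    qed
  qed
  also have "\<dots> = emeasure (lborel \<Otimes>\<^sub>M lborel) (close_pairs L S)"
    using close_pairs_borel[OF L S(1) SL]
    by (intro lborel.emeasure_pair_measure_alt[symmetric]) (simp only: lborel_prod sets_lborel)
  also have "\<dots> = emeasure lebesgue (close_pairs L S)"
    using close_pairs_borel[OF L S(1) SL] by (simp add: lborel_prod borel_prod)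
  also have "\<dots> \<le> emeasure lebesgue (close_pairs L A)"
    using close_pairs_fmeasurable[OF L A] S(2) by (intro emeasure_mono) (auto simp: close_pairs_def)
  also have "\<dots> = ennreal (Phi L A)"
    unfolding Phi_close_pairs using close_pairs_fmeasurable[OF L A] by (rule emeasure_eq_measure2)
  finally have "(\<Sum>a<N. \<mu> a * w a) \<le> Phi L A"
    by (simp add: Phi_def)
  then show ?thesis by (simp add: w_def \<mu>_def I_def sum_distrib_left)
qed

lemma Phi_bound_approx:
  fixes L \<xi> e :: real
  assumes L: "L \<ge> 1" and A: "A \<in> sets lebesgue" "A \<subseteq> {0..<L}" "measure lebesgue A = \<xi> * L" and e: "e > 0"
  shows "Phi L A \<ge> (\<xi> + sqrt (2 * \<xi>\<^sup>2 - 2 * \<xi> + 1) - 1) * L - e"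
proof -
  define S where "S = main_part lborel A"
  have S: "S \<in> sets borel" using A(1) main_part_sets[of A lborel] by (simp add: S_def)
  have SA: "S \<subseteq> A" using main_part_null_part_Un[of A lborel] A(1) unfolding S_def by blast
  have mS: "measure lborel S = \<xi> * L"
    using A by (simp add: measure_def emeasure_completion S_def)
  \<comment> \<open>The summand \<open>L\<close> forces \<open>h \<le> 1\<close>; the other one
    makes the cell error at most \<open>e / 2\<close>. The sign of \<open>\<xi>\<close> is only
    established later, hence the absolute value.\<close>
  obtain N :: nat where N: "real N > L + 6 * \<bar>\<xi>\<bar> * L * L / e" using reals_Archimedean2 by blast
  have "0 \<le> 6 * \<bar>\<xi>\<bar> * L * L / e" using L e by simp
  then have NL: "real N > L" and N0: "N > 0" using N L by auto
  define h where "h = L / real N"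
  have h: "0 < h" "h \<le> 1" "L = real N * h" using NL L N0 by (auto simp: h_def)
  define I where "I a = {real a * h..<real (Suc a) * h}" for a
  define \<mu> where "\<mu> a = measure lborel (S \<inter> I a)" for a
  have mI: "measure lborel (I a) = h" for a
    using h by (simp add: I_def algebra_simps)
  have fin: "emeasure lborel (I a) \<noteq> \<infinity>" for a
    using emeasure_bounded_finite[of "I a"] by (simp add: I_def)
  have \<mu>: "0 \<le> \<mu> a" "\<mu> a \<le> h" for a
  proof -
    have "measure lborel (S \<inter> I a) \<le> measure lborel (I a)"
      using fin[of a] by (intro measure_mono_fmeasurable) (auto simp: I_def S fmeasurable_def top.not_eq_extremum)
    then show "0 \<le> \<mu> a" "\<mu> a \<le> h" by (simp_all add: \<mu>_def mI)
  qed
  have sum: "(\<Sum>a<N. \<mu> a) = \<xi> * L"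
  proof -
    have "S \<subseteq> (\<Union>a<N. I a)"
    proof
      fix x assume "x \<in> S"
      then have x: "0 \<le> x" "x < L" using SA A by auto
      define a where "a = nat \<lfloor>x / h\<rfloor>"
      have "real a = of_int \<lfloor>x / h\<rfloor>" using x h by (simp add: a_def)
      then have "real a \<le> x / h" "x / h < real a + 1" by linarith+
      then have a: "real a * h \<le> x" "x < real (Suc a) * h" using h(1) by (simp_all add: field_simps)
      have "real a * h < real N * h" using a(1) x(2) h(3) by simp
      then have "a < N" using h(1) by simp
      with a show "x \<in> (\<Union>a<N. I a)" by (auto simp: I_def)
    qed
    then have "S = (\<Union>a\<in>{..<N}. S \<inter> I a)" by blast
    then have "measure lborel S = measure lborel (\<Union>a\<in>{..<N}. S \<inter> I a)" by simp
    also have "\<dots> = (\<Sum>a<N. measure lborel (S \<inter> I a))"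
    proof (rule measure_finite_Union)
      show "(\<lambda>a. S \<inter> I a) ` {..<N} \<subseteq> sets lborel" using S by (auto simp: I_def)
      have disj: "I a \<inter> I b = {}" if "a < b" for a b
      proof -
        have "real (Suc a) * h \<le> real b * h" using that h(1) by (intro mult_right_mono) auto
        then show ?thesis by (auto simp: I_def)
      qed
      show "disjoint_family_on (\<lambda>a. S \<inter> I a) {..<N}"
        unfolding disjoint_family_on_def
      proof (intro ballI impI)
        fix a b :: nat assume "a \<noteq> b"
        then have "I a \<inter> I b = {}" using disj[of a b] disj[of b a] by (cases "a < b") auto
        then show "S \<inter> I a \<inter> (S \<inter> I b) = {}" by blast
      qed
      show "emeasure lborel (S \<inter> I a) \<noteq> \<infinity>" for a
        using emeasure_bounded_finite[of "S \<inter> I a"] by (simp add: I_def bounded_Int)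
    qed simp
    finally show ?thesis by (simp add: \<mu>_def mS)
  qed
  have \<xi>: "0 \<le> \<xi>" "\<xi> \<le> 1"
  proof -
    have "0 \<le> (\<Sum>a<N. \<mu> a)" "(\<Sum>a<N. \<mu> a) \<le> (\<Sum>a<N. h)" by (intro sum_nonneg sum_mono \<mu>)+
    then have "0 \<le> \<xi> * L" "\<xi> * L \<le> 1 * L" unfolding sum using h(3) by simp_all
    then show "0 \<le> \<xi>" "\<xi> \<le> 1" using L by (simp_all add: zero_le_mult_iff)
  qed
  obtain q :: nat where q: "real q > 2 / e" using reals_Archimedean2 by blast
  have q0: "0 < q" using q e by (cases "q = 0") (auto simp: field_simps)
  \<comment> \<open>The largest \<open>m\<close> with \<open>(m + 1) * h \<le> 1\<close>, so that
    \<open>m + 2\<close> cells already exceed length 1.\<close>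
  define m where "m = nat \<lfloor>1 / h\<rfloor> - 1"
  have "1 \<le> \<lfloor>1 / h\<rfloor>" using h by simp
  then have "real m + 1 = of_int \<lfloor>1 / h\<rfloor>" unfolding m_def by linarith
  then have "real m + 1 \<le> 1 / h" "1 / h < real m + 2" by linarith+
  then have m: "(real m + 1) * h \<le> 1" "1 \<le> (real m + 2) * h" using h(1) by (simp_all add: field_simps)
  have "3 * h * (\<xi> * L) \<le> e / 2"
  proof -
    have "6 * \<xi> * L * L / e \<le> real N" using N L \<xi> by simp
    then show ?thesis using e N0 by (simp add: h_def field_simps)
  qed
  moreover have "1 / real q \<le> e / 2" using q q0 e by (simp add: field_simps)
  moreover have "(\<Sum>a<N. \<Sum>j=1..m. \<mu> a * \<mu> ((a + j) mod N)) \<ge>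
      (\<xi> + sqrt (2 * \<xi>\<^sup>2 - 2 * \<xi> + 1) - 1) * L - 3 * h * (\<xi> * L) - 1 / real q"
    by (rule cell_correlation_ge) (use N0 h_def h m \<mu> sum \<xi> q0 in auto)
  moreover have "Phi L A \<ge> (\<Sum>a<N. \<Sum>j=1..m. \<mu> a * \<mu> ((a + j) mod N))"
    unfolding \<mu>_def I_def by (rule Phi_ge_sections) (use L A S SA h m in auto)
  ultimately show ?thesis by linarith
qed

theorem theorem1p2:
  fixes L \<xi> :: real and A :: "real set"
  assumes "L \<ge> 1"
    and "A \<in> sets (circle_measure L)"
    and "measure (circle_measure L) A = \<xi> * L"
  shows "Phi L A \<ge> (\<xi> + sqrt (2 * \<xi>\<^sup>2 - 2 * \<xi> + 1) - 1) * L"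
proof -
  have A: "A \<in> sets lebesgue" "A \<subseteq> {0..<L}"
    using assms(2) by (auto simp: circle_measure_def circle_def sets_restrict_space_iff)
  moreover have "measure lebesgue A = \<xi> * L"
    using assms(3) A by (simp add: circle_measure_def circle_def measure_restrict_space)
  ultimately have "(\<xi> + sqrt (2 * \<xi>\<^sup>2 - 2 * \<xi> + 1) - 1) * L \<le> Phi L A + e" if "e > 0" for e
    using Phi_bound_approx[OF assms(1), of A \<xi> e] that by linarith
  then show ?thesis by (rule field_le_epsilon)
qed

end
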